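(* Let $W$ be a Weyl group of type $E_7$, $E_8$, or $D_n$ with $n=2k\ge4$, with root system $\Phi$, positive roots $\Phi_+$ and simple reflections $S$. Then $(W,S,\Phi_+)$ is a transitive QP-triple.
   Context: For a simply laced root system $\Phi$ with simple roots $\{\alpha_i\}$ and $W$-invariant form $B$ ($B(\alpha_i,\alpha_i)=2$, $-1$ for adjacent nodes, $0$ otherwise), $s_\alpha(\beta)=\beta-B(\alpha,\beta)\alpha$, $S=\{s_{\alpha_i}\}$, $W_J=\langle J\rangle$. For a root $\alpha$, $|\alpha|$ is the positive root among $\pm\alpha$; the standard action of $W$ on sets $R$ of pairwise orthogonal positive roots is $w\cdot R=\{|w(\alpha)|:\alpha\in R\}$. For $U\subseteq\Phi_+$: $\kappa$ is the maximal size of a pairwise orthogonal subset of $U$, $\Omega_U$ the set of pairwise orthogonal subsets of $U$ of size $\kappa$; $\mathrm{Res}_U(R)=\{\gamma\in U: s_\beta(\gamma)\in\Phi_+ \ \forall\beta\in R\}$, $\rho_U(R)=|\mathrm{Res}_U(R)|$. Quasiparabolic sets: for a Coxeter system $(W',S')$ with reflections $T'=\{wsw^{-1}\}$, a scaled $W'$-set is a $W'$-set $X$ with $\lambda:X\to\mathbb Z$, $|\lambda(sx)-\lambda(x)|\le1$ for $s\in S'$; it is quasiparabolic if (QP1) $r\in T'$, $\lambda(rx)=\lambda(x)\Rightarrow rx=x$; (QP2) $r\in T'$, $s\in S'$, $\lambda(rx)>\lambda(x)$ and $\lambda(srx)<\lambda(sx)\Rightarrow rx=sx$. For $I\subseteq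 S$, $(W,I,U)$ is a QP-triple if $\Omega_U$ is a quasiparabolic $W_I$-set under the restricted standard action with level function $\rho_U$; it is transitive if moreover $W_I$ acts transitively on $\Omega_U$. *)

theory Defs
  imports "HOL-Algebra.Group_Action" "HOL-Algebra.Generated_Groups"
begin

section \<open>Simply laced root systems\<close>

text \<open>Dynkin diagrams carry the Bourbaki labelling: type D is the path 1 - 2 - ... - (n-1) with n
  attached to n-2; type E is the path 1 - 3 - 4 - ... - n with 2 attached to 4.\<close>

record diagram =
  nodes :: "nat set"
  edges :: "nat set set"

definition diagram_D :: "nat \<Rightarrow> diagram" where
  "diagram_D n = \<lparr>nodes = {1..n},
     edges = {{i, i + 1} | i. 1 \<le> i \<and> i + 1 \<le> n - 1} \<union> {{n - 2, n}}\<rparr>"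

definition diagram_E :: "nat \<Rightarrow> diagram" where
  "diagram_E n = \<lparr>nodes = {1..n},
     edges = {{i, i + 1} | i. 3 \<le> i \<and> i + 1 \<le> n} \<union> {{1, 3}, {2, 4}}\<rparr>"

text \<open>A vector \<open>v :: nat \<Rightarrow> int\<close> stands for the element \<open>\<Sum>i. v i \<cdot> \<alpha>\<^sub>i\<close> of the root lattice.
  Coordinates outside the node set are ignored by the form and left unchanged by the simple
  reflections, so letting the Weyl group act on all of \<open>nat \<Rightarrow> int\<close> gives the same group as letting
  it act on the root lattice; all roots vanish outside the node set.\<close>

type_synonym vec = "nat \<Rightarrow> int"

definition simple_root :: "nat \<Rightarrow> vec" where
  "simple_root i = (\<lambda>j. if j = i then 1 else 0)"

definition cartan :: "diagram \<Rightarrow> nat \<Rightarrow> nat \<Rightarrow> int" where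
  "cartan \<Gamma> i j = (if i = j then 2 else if {i, j} \<in> edges \<Gamma> then -1 else 0)"

definition form :: "diagram \<Rightarrow> vec \<Rightarrow> vec \<Rightarrow> int" where
  "form \<Gamma> v w = (\<Sum>i\<in>nodes \<Gamma>. \<Sum>j\<in>nodes \<Gamma>. v i * w j * cartan \<Gamma> i j)"

definition reflection :: "diagram \<Rightarrow> vec \<Rightarrow> vec \<Rightarrow> vec" where
  "reflection \<Gamma> \<alpha> \<beta> = (\<lambda>j. \<beta> j - form \<Gamma> \<alpha> \<beta> * \<alpha> j)"

definition simple_reflections :: "diagram \<Rightarrow> (vec \<Rightarrow> vec) set" where
  "simple_reflections \<Gamma> = (\<lambda>i. reflection \<Gamma> (simple_root i)) ` nodes \<Gamma>"

text \<open>\<^const>\<open>subgroup_generated\<close> discards generators outside the ambient group; the next lemmas show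
  that no simple reflection is lost.\<close>

lemma form_simple_root_self:
  assumes "finite (nodes \<Gamma>)" "i \<in> nodes \<Gamma>"
  shows "form \<Gamma> (simple_root i) (simple_root i) = 2"
proof -
  have "form \<Gamma> (simple_root i) (simple_root i)
      = (\<Sum>k\<in>nodes \<Gamma>. \<Sum>j\<in>nodes \<Gamma>. if j = i then (if k = i then cartan \<Gamma> i i else 0) else 0)"
    unfolding form_def simple_root_def by (intro sum.cong refl) auto
  also have "\<dots> = 2"
    using assms by (simp add: cartan_def)
  finally show ?thesis .
qed

lemma reflection_reflection:
  assumes "form \<Gamma> \<alpha> \<alpha> = 2"
  shows "reflection \<Gamma> \<alpha> (reflection \<Gamma> \<alpha> \<beta>) = \<beta>"
proof -
  define c where "c = form \<Gamma> \<alpha> \<beta>"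
  have "form \<Gamma> \<alpha> (\<lambda>j. \<beta> j - c * \<alpha> j) = form \<Gamma> \<alpha> \<beta> - c * form \<Gamma> \<alpha> \<alpha>"
    by (simp add: form_def algebra_simps sum_subtractf sum_distrib_left)
  then have "form \<Gamma> \<alpha> (reflection \<Gamma> \<alpha> \<beta>) = form \<Gamma> \<alpha> \<beta> - form \<Gamma> \<alpha> \<beta> * form \<Gamma> \<alpha> \<alpha>"
    by (simp add: reflection_def c_def)
  then show ?thesis
    using assms by (simp add: reflection_def fun_eq_iff)
qed

lemma simple_reflections_subset_BijGroup:
  assumes "finite (nodes \<Gamma>)"
  shows "simple_reflections \<Gamma> \<subseteq> carrier (BijGroup UNIV)"
proof -
  have "bij (reflection \<Gamma> (simple_root i))" if "i \<in> nodes \<Gamma>" for i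
    by (rule involuntory_imp_bij) (rule reflection_reflection[OF form_simple_root_self[OF assms that]])
  then show ?thesis
    by (auto simp: simple_reflections_def BijGroup_def Bij_def)
qed

definition parabolic_subgroup :: "(vec \<Rightarrow> vec) set \<Rightarrow> (vec \<Rightarrow> vec) monoid" where
  "parabolic_subgroup J = subgroup_generated (BijGroup UNIV) J"

definition weyl_group :: "diagram \<Rightarrow> (vec \<Rightarrow> vec) monoid" where
  "weyl_group \<Gamma> = parabolic_subgroup (simple_reflections \<Gamma>)"

definition roots :: "diagram \<Rightarrow> vec set" where
  "roots \<Gamma> = {w (simple_root i) | w i. w \<in> carrier (weyl_group \<Gamma>) \<and> i \<in> nodes \<Gamma>}"

definition positive_roots :: "diagram \<Rightarrow> vec set" where
  "positive_roots \<Gamma> = {\<alpha> \<in> roots \<Gamma>. \<forall>i. 0 \<le> \<alpha> i}"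

definition abs_root :: "diagram \<Rightarrow> vec \<Rightarrow> vec" where
  "abs_root \<Gamma> \<alpha> = (if \<alpha> \<in> positive_roots \<Gamma> then \<alpha> else (\<lambda>i. - \<alpha> i))"

section \<open>Orthogonal sets of positive roots\<close>

definition standard_action :: "diagram \<Rightarrow> (vec \<Rightarrow> vec) \<Rightarrow> vec set \<Rightarrow> vec set" where
  "standard_action \<Gamma> w R = (\<lambda>\<alpha>. abs_root \<Gamma> (w \<alpha>)) ` R"

definition orthogonal_set :: "diagram \<Rightarrow> vec set \<Rightarrow> bool" where
  "orthogonal_set \<Gamma> R \<longleftrightarrow> pairwise (\<lambda>\<alpha> \<beta>. form \<Gamma> \<alpha> \<beta> = 0) R"

definition kappa :: "diagram \<Rightarrow> vec set \<Rightarrow> nat" where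
  "kappa \<Gamma> U = Max {card R | R. R \<subseteq> U \<and> orthogonal_set \<Gamma> R}"

definition Omega :: "diagram \<Rightarrow> vec set \<Rightarrow> vec set set" where
  "Omega \<Gamma> U = {R. R \<subseteq> U \<and> orthogonal_set \<Gamma> R \<and> card R = kappa \<Gamma> U}"

definition Res :: "diagram \<Rightarrow> vec set \<Rightarrow> vec set \<Rightarrow> vec set" where
  "Res \<Gamma> U R = {\<gamma> \<in> U. \<forall>\<beta>\<in>R. reflection \<Gamma> \<beta> \<gamma> \<in> positive_roots \<Gamma>}"

definition rho :: "diagram \<Rightarrow> vec set \<Rightarrow> vec set \<Rightarrow> int" where
  "rho \<Gamma> U R = int (card (Res \<Gamma> U R))"

section \<open>Quasiparabolic sets\<close>

text \<open>These notions are intended for a Coxeter system \<open>(G, S)\<close>. As in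
  \<^locale>\<open>group_action\<close>, an action on \<open>X\<close> is a homomorphism \<open>\<phi>\<close> into \<^term>\<open>BijGroup X\<close>.\<close>

definition coxeter_reflections :: "('g, 'm) monoid_scheme \<Rightarrow> 'g set \<Rightarrow> 'g set" where
  "coxeter_reflections G S = {w \<otimes>\<^bsub>G\<^esub> s \<otimes>\<^bsub>G\<^esub> inv\<^bsub>G\<^esub> w | w s. w \<in> carrier G \<and> s \<in> S}"

definition scaled_set ::
  "('g, 'm) monoid_scheme \<Rightarrow> 'g set \<Rightarrow> 'x set \<Rightarrow> ('g \<Rightarrow> 'x \<Rightarrow> 'x) \<Rightarrow> ('x \<Rightarrow> int) \<Rightarrow> bool" where
  "scaled_set G S X \<phi> lev \<longleftrightarrow>
     group_action G X \<phi> \<and> (\<forall>s\<in>S. \<forall>x\<in>X. \<bar>lev (\<phi> s x) - lev x\<bar> \<le> 1)"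

definition quasiparabolic ::
  "('g, 'm) monoid_scheme \<Rightarrow> 'g set \<Rightarrow> 'x set \<Rightarrow> ('g \<Rightarrow> 'x \<Rightarrow> 'x) \<Rightarrow> ('x \<Rightarrow> int) \<Rightarrow> bool" where
  "quasiparabolic G S X \<phi> lev \<longleftrightarrow>
     scaled_set G S X \<phi> lev \<and>
     (\<forall>r\<in>coxeter_reflections G S. \<forall>x\<in>X. lev (\<phi> r x) = lev x \<longrightarrow> \<phi> r x = x) \<and>
     (\<forall>r\<in>coxeter_reflections G S. \<forall>s\<in>S. \<forall>x\<in>X.
        lev (\<phi> r x) > lev x \<and> lev (\<phi> s (\<phi> r x)) < lev (\<phi> s x) \<longrightarrow> \<phi> r x = \<phi> s x)"

text \<open>The standard action is restricted to \<^term>\<open>Omega \<Gamma> U\<close> because the elements of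
  \<^term>\<open>BijGroup X\<close> are extensional functions on \<open>X\<close>.\<close>

definition Omega_action :: "diagram \<Rightarrow> vec set \<Rightarrow> (vec \<Rightarrow> vec) \<Rightarrow> vec set \<Rightarrow> vec set" where
  "Omega_action \<Gamma> U w = restrict (standard_action \<Gamma> w) (Omega \<Gamma> U)"

text \<open>A triple \<open>(W, I, U)\<close> is represented by the diagram of \<open>W\<close> together with \<open>I\<close> and \<open>U\<close>.\<close>

definition QP_triple :: "diagram \<Rightarrow> (vec \<Rightarrow> vec) set \<Rightarrow> vec set \<Rightarrow> bool" where
  "QP_triple \<Gamma> I U \<longleftrightarrow>
     I \<subseteq> simple_reflections \<Gamma> \<and> U \<subseteq> positive_roots \<Gamma> \<and>
     quasiparabolic (parabolic_subgroup I) I (Omega \<Gamma> U) (Omega_action \<Gamma> U) (rho \<Gamma> U)"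

definition transitive_QP_triple :: "diagram \<Rightarrow> (vec \<Rightarrow> vec) set \<Rightarrow> vec set \<Rightarrow> bool" where
  "transitive_QP_triple \<Gamma> I U \<longleftrightarrow>
     QP_triple \<Gamma> I U \<and>
     transitive_action (parabolic_subgroup I) (Omega \<Gamma> U) (Omega_action \<Gamma> U)"

end

theory Submission
  imports Defs
begin

text \<open>Only one feature of the diagram matters: there is an orthogonal set \<open>R0\<close> of vectors of norm 2 with
  nonnegative coordinates whose rational span contains all simple roots. Parseval's identity for \<open>R0\<close>
  makes the form positive definite, so the roots are the vectors of norm 2, every \<open>R \<in> \<Omega>\<close> is an orthogonal
  basis, and a root \<open>\<alpha> \<notin> \<plusminus>R\<close> is a signed half-sum of exactly four elements of \<open>R\<close>. These four span a
  \<open>D\<^sub>4\<close> subsystem whose positive roots split into three orthogonal quadruples; the number of elements of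
  \<open>Res\<close> that a quadruple supports is its local level, and the three levels are 0, 1 and 2.

  A simple reflection changes \<open>\<rho>\<close> only through the quadruple supporting the simple root, by \<open>\<plusminus>1\<close>. If
  no simple reflection lowers \<open>\<rho>\<close>, then \<open>R\<close> is Kostant's cascade; hence the minimal \<open>R\<close> is unique, it
  has \<open>\<rho> = 0\<close>, and the action is transitive. Descending to it, one shows as for the strong exchange
  condition that the sign of \<open>\<rho>(s\<^sub>\<alpha>R) - \<rho>(R)\<close> is the sign of the local level change in the \<open>D\<^sub>4\<close>
  subsystem of \<open>\<alpha>\<close>. This gives (QP1) and reduces (QP2) to a check inside \<open>D\<^sub>4\<close>.\<close>

section \<open>The form, heights and reflections\<close>

text \<open>A reflection in a non-simple root disturbs \<open>Res\<close> on many quadruples at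
  once, so \<open>rho\<close> before and after it cannot be compared directly. A simple reflection
  is manageable because it permutes the positive roots other than its own root, and membership of
  \<gamma> in \<open>Res\<close> is decided by roots that all lie over the same elements of
  \<open>R\<close> as \<gamma>. The local level therefore plays the part that the sign of
  w(\<alpha>) plays for Coxeter groups: it is transported by simple reflections and can be computed
  from four integers, and an induction on \<open>rho\<close> turns its change into the change of
  \<open>rho\<close>. The number four comes from Parseval's identity: the products of a root with an
  orthogonal basis of roots lie between -2 and 2 and their squares sum to 4. Heights enter because a
  root has the sign of its height, which makes the facts about D4 statements of linear arithmetic.
  The types E7, E8 and D with even rank enter only through an explicit \<open>R0\<close>, namely
  Kostant's cascade of highest roots.\<close>

definition height :: "diagram \<Rightarrow> vec \<Rightarrow> int" where
  "height \<Gamma> v = (\<Sum>i\<in>nodes \<Gamma>. v i)"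

text \<open>The form does not see coordinates outside the nodes, so definiteness and finiteness can
  hold only for vectors that vanish there.\<close>

definition supported :: "diagram \<Rightarrow> vec \<Rightarrow> bool" where
  "supported \<Gamma> v \<longleftrightarrow> (\<forall>i. i \<notin> nodes \<Gamma> \<longrightarrow> v i = 0)"

lemma form_add_left: "form \<Gamma> (\<lambda>j. u j + v j) w = form \<Gamma> u w + form \<Gamma> v w"
  by (simp add: form_def algebra_simps sum.distrib)

lemma form_smult_left: "form \<Gamma> (\<lambda>j. c * u j) w = c * form \<Gamma> u w"
  by (simp add: form_def sum_distrib_left mult.assoc)

lemma form_commute: "form \<Gamma> u v = form \<Gamma> v u"
proof -
  have "cartan \<Gamma> i j = cartan \<Gamma> j i" for i j
    by (simp add: cartan_def insert_commute)
  then show ?thesis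
    unfolding form_def by (subst sum.swap) (simp add: mult.commute mult.left_commute)
qed

lemma form_add_right: "form \<Gamma> w (\<lambda>j. u j + v j) = form \<Gamma> w u + form \<Gamma> w v"
  by (metis form_add_left form_commute)

lemma form_smult_right: "form \<Gamma> w (\<lambda>j. c * u j) = c * form \<Gamma> w u"
  by (metis form_smult_left form_commute)

lemma form_diff_left: "form \<Gamma> (\<lambda>j. u j - v j) w = form \<Gamma> u w - form \<Gamma> v w"
  by (simp add: form_def algebra_simps sum_subtractf)

lemma form_diff_right: "form \<Gamma> w (\<lambda>j. u j - v j) = form \<Gamma> w u - form \<Gamma> w v"
  by (metis form_diff_left form_commute)

lemma form_uminus_left: "form \<Gamma> (\<lambda>j. - u j) w = - form \<Gamma> u w"
  by (simp add: form_def sum_negf)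

lemma form_uminus_right: "form \<Gamma> w (\<lambda>j. - u j) = - form \<Gamma> w u"
  by (metis form_uminus_left form_commute)

lemma form_sum_left: "form \<Gamma> (\<lambda>j. \<Sum>b\<in>A. f b j) w = (\<Sum>b\<in>A. form \<Gamma> (f b) w)"
proof (induction A rule: infinite_finite_induct)
  case (insert x F)
  then show ?case
    by (simp add: form_add_left)
qed (auto simp: form_def)

lemmas form_linear =
  form_add_left form_add_right form_diff_left form_diff_right form_smult_left form_smult_right
  form_uminus_left form_uminus_right

lemma height_add: "height \<Gamma> (\<lambda>j. u j + v j) = height \<Gamma> u + height \<Gamma> v"
  by (simp add: height_def sum.distrib)

lemma height_diff: "height \<Gamma> (\<lambda>j. u j - v j) = height \<Gamma> u - height \<Gamma> v"
  by (simp add: height_def sum_subtractf)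

lemma height_smult: "height \<Gamma> (\<lambda>j. c * u j) = c * height \<Gamma> u"
  by (simp add: height_def sum_distrib_left)

lemma height_uminus: "height \<Gamma> (\<lambda>j. - u j) = - height \<Gamma> u"
  by (simp add: height_def sum_negf)

lemmas height_linear = height_add height_diff height_smult height_uminus

lemma form_simple_root_left:
  assumes "finite (nodes \<Gamma>)" "i \<in> nodes \<Gamma>"
  shows "form \<Gamma> (simple_root i) v = (\<Sum>j\<in>nodes \<Gamma>. v j * cartan \<Gamma> i j)"
proof -
  have "form \<Gamma> (simple_root i) v = (\<Sum>k\<in>nodes \<Gamma>. if k = i then \<Sum>j\<in>nodes \<Gamma>. v j * cartan \<Gamma> i j else 0)"
    unfolding form_def simple_root_def by (intro sum.cong refl) auto
  then show ?thesis
    using assms by simp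
qed

lemma form_expand_left:
  assumes "finite (nodes \<Gamma>)"
  shows "form \<Gamma> v w = (\<Sum>i\<in>nodes \<Gamma>. v i * form \<Gamma> (simple_root i) w)"
  by (simp add: form_def[of \<Gamma> v] form_simple_root_left[OF assms] sum_distrib_left mult.assoc)

text \<open>Off-diagonal terms come in equal pairs and diagonal terms carry the factor 2.\<close>

lemma even_form_self:
  assumes "finite (nodes \<Gamma>)"
  shows "even (form \<Gamma> v v)"
proof -
  have "even (\<Sum>i\<in>N. \<Sum>j\<in>N. v i * v j * cartan \<Gamma> i j)" if "finite N" for N
    using that
  proof (induction N)
    case (insert a N)
    have c: "cartan \<Gamma> i j = cartan \<Gamma> j i" for i j
      by (simp add: cartan_def insert_commute)
    have "(\<Sum>i\<in>insert a N. \<Sum>j\<in>insert a N. v i * v j * cartan \<Gamma> i j)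
      = v a * v a * cartan \<Gamma> a a + (\<Sum>i\<in>N. v i * v a * cartan \<Gamma> i a)
        + (\<Sum>j\<in>N. v a * v j * cartan \<Gamma> a j) + (\<Sum>i\<in>N. \<Sum>j\<in>N. v i * v j * cartan \<Gamma> i j)"
      using insert.hyps by (simp add: sum.distrib algebra_simps)
    also have "(\<Sum>i\<in>N. v i * v a * cartan \<Gamma> i a) = (\<Sum>j\<in>N. v a * v j * cartan \<Gamma> a j)"
      by (intro sum.cong refl) (simp add: c[of _ a])
    finally show ?case
      using insert.IH by (simp add: cartan_def)
  qed simp
  then show ?thesis
    using assms by (simp add: form_def)
qed

lemma reflection_linear:
  "reflection \<Gamma> \<alpha> (\<lambda>j. u j + c * v j) = (\<lambda>j. reflection \<Gamma> \<alpha> u j + c * reflection \<Gamma> \<alpha> v j)"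
  by (simp add: reflection_def form_linear algebra_simps)

lemma reflection_isometry:
  assumes "form \<Gamma> \<alpha> \<alpha> = 2"
  shows "form \<Gamma> (reflection \<Gamma> \<alpha> u) (reflection \<Gamma> \<alpha> v) = form \<Gamma> u v"
  using assms
  by (simp add: reflection_def form_linear form_commute[of _ u \<alpha>])

lemma reflection_uminus_left: "reflection \<Gamma> (\<lambda>j. - \<alpha> j) = reflection \<Gamma> \<alpha>"
  by (simp add: reflection_def form_linear fun_eq_iff)

section \<open>Local levels in type D4\<close>

text \<open>For a quadruple of orthogonal roots with half-sum a root, of heights \<open>a, b, c, d\<close>, \<open>level4\<close> counts
  the half-sums (with signs) that are positive and stay positive after changing any one sign.\<close>

definition stable4 :: "int \<Rightarrow> int \<Rightarrow> int \<Rightarrow> int \<Rightarrow> int \<times> int \<times> int \<times> int \<Rightarrow> bool" where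
  "stable4 a b c d = (\<lambda>(p, q, r, s). let t = p * a + q * b + r * c + s * d in
     0 < t \<and> 2 * (p * a) < t \<and> 2 * (q * b) < t \<and> 2 * (r * c) < t \<and> 2 * (s * d) < t)"

definition signs4 :: "(int \<times> int \<times> int \<times> int) set" where
  "signs4 = {1, -1} \<times> {1, -1} \<times> {1, -1} \<times> {1, -1}"

definition level4 :: "int \<Rightarrow> int \<Rightarrow> int \<Rightarrow> int \<Rightarrow> nat" where
  "level4 a b c d = card {x \<in> signs4. stable4 a b c d x}"

lemma sum_signs: "(\<Sum>p\<in>{1, - 1 :: int}. f p) = f 1 + f (- 1)"
  by simp

lemma level4_sum: "int (level4 a b c d) = (\<Sum>x\<in>signs4. of_bool (stable4 a b c d x))"
  by (simp add: level4_def signs4_def Int_def)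

lemmas level4_expand =
  level4_sum[unfolded signs4_def sum.cartesian_product' sum_signs stable4_def Let_def prod.case mult_1 mult_minus1]

text \<open>The twelve inequations say that no positive root of the D4 subsystem has height 0: the
  four roots of the quadruple, their half-sum, the four half-sums with one sign changed and, up to
  sign, the three with two signs changed.\<close>

definition generic4 :: "int \<Rightarrow> int \<Rightarrow> int \<Rightarrow> int \<Rightarrow> int \<Rightarrow> bool" where
  "generic4 a b c d e \<longleftrightarrow> a + b + c + d = 2 * e \<and> e \<noteq> 0 \<and> a \<noteq> 0 \<and> b \<noteq> 0 \<and> c \<noteq> 0 \<and> d \<noteq> 0 \<and>
     a \<noteq> e \<and> b \<noteq> e \<and> c \<noteq> e \<and> d \<noteq> e \<and> a + b \<noteq> e \<and> a + c \<noteq> e \<and> a + d \<noteq> e"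

text \<open>Changing one sign of a half-sum gives another half-sum, so all sixteen stability
  conditions reduce to the signs of eight numbers: \<open>e\<close>, the differences of
  \<open>e\<close> with one of the four heights, and \<open>e - a - b\<close>,
  \<open>e - a - c\<close>, \<open>e - a - d\<close>.\<close>

lemma level4_formula:
  assumes "a + b + c + d = 2 * e"
  shows "int (level4 a b c d) =
     of_bool (0 < e \<and> a < e \<and> b < e \<and> c < e \<and> d < e) +
     of_bool (d < e \<and> a + d < e \<and> e < a + c \<and> e < a + b \<and> 0 < e) +
     of_bool (c < e \<and> a + c < e \<and> e < a + d \<and> 0 < e \<and> e < a + b) +
     of_bool (e < a + b \<and> e < b \<and> e < a \<and> d < e \<and> c < e) +
     of_bool (b < e \<and> a + b < e \<and> 0 < e \<and> e < a + d \<and> e < a + c) +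
     of_bool (e < a + c \<and> e < c \<and> d < e \<and> e < a \<and> b < e) +
     of_bool (e < a + d \<and> e < d \<and> c < e \<and> b < e \<and> e < a) +
     of_bool (e < a \<and> e < 0 \<and> e < a + b \<and> e < a + c \<and> e < a + d) +
     of_bool (a < e \<and> 0 < e \<and> a + b < e \<and> a + c < e \<and> a + d < e) +
     of_bool (a + d < e \<and> d < e \<and> e < c \<and> e < b \<and> a < e) +
     of_bool (a + c < e \<and> c < e \<and> e < d \<and> a < e \<and> e < b) +
     of_bool (e < b \<and> e < a + b \<and> e < 0 \<and> a + d < e \<and> a + c < e) +
     of_bool (a + b < e \<and> b < e \<and> a < e \<and> e < d \<and> e < c) +
     of_bool (e < c \<and> e < a + c \<and> a + d < e \<and> e < 0 \<and> a + b < e) +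
     of_bool (e < d \<and> e < a + d \<and> a + c < e \<and> a + b < e \<and> e < 0) +
     of_bool (e < 0 \<and> e < a \<and> e < b \<and> e < c \<and> e < d)"
proof -
  have d: "d = 2 * e - a - b - c"
    using assms by linarith
  show ?thesis
    unfolding level4_expand add.assoc[symmetric]
    apply (intro arg_cong2[where f = "(+)"] arg_cong[where f = of_bool] arg_cong2[where f = "(\<and>)"])
    using d apply (linarith+)
    done
qed

text \<open>Reflecting in the half-sum lowers each height by \<open>e\<close> and negates
  \<open>e\<close>; a simple root has \<open>e = 1\<close>. Ties are allowed in the ordering because
  distinct roots may share a height. The conclusion \<open>a + d > 0\<close> says that
  \<open>d\<close> has the largest absolute value; dominance in minimal sets rests on it.\<close>

lemma level4_simple:
  assumes g: "generic4 a b c d 1" and o: "a \<le> b" "b \<le> c" "c \<le> d"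
  shows "\<bar>int (level4 (a - 1) (b - 1) (c - 1) (d - 1)) - int (level4 a b c d)\<bar> = 1"
    and "level4 a b c d < level4 (a - 1) (b - 1) (c - 1) (d - 1) \<Longrightarrow> a + d > 0"
proof -
  have s: "a + b + c + d = 2 * 1"
    using g by (simp only: generic4_def)
  then have s': "a - 1 + (b - 1) + (c - 1) + (d - 1) = 2 * (-1)"
    by linarith
  have nz: "a \<noteq> 0" "b \<noteq> 0" "c \<noteq> 0" "d \<noteq> 0" "a \<noteq> 1" "b \<noteq> 1" "c \<noteq> 1" "d \<noteq> 1"
    "a + b \<noteq> 1" "a + c \<noteq> 1" "a + d \<noteq> 1"
    using g by (simp_all add: generic4_def)
  have "\<bar>int (level4 (a - 1) (b - 1) (c - 1) (d - 1)) - int (level4 a b c d)\<bar> = 1 \<and>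
     (int (level4 a b c d) < int (level4 (a - 1) (b - 1) (c - 1) (d - 1)) \<longrightarrow> a + d > 0)"
    unfolding level4_formula[OF s] level4_formula[OF s'] of_bool_def
    using nz o s by (smt (verit))
  then show "\<bar>int (level4 (a - 1) (b - 1) (c - 1) (d - 1)) - int (level4 a b c d)\<bar> = 1"
    and "level4 a b c d < level4 (a - 1) (b - 1) (c - 1) (d - 1) \<Longrightarrow> a + d > 0"
    by simp_all
qed

text \<open>For a root of arbitrary positive height the level may also jump by 2, when the
  quadruples of levels 0 and 2 are exchanged, so only the inequality remains.\<close>

lemma level4_neq:
  assumes g: "generic4 a b c d e" and o: "a \<le> b" "b \<le> c" "c \<le> d" and e: "0 < e"
  shows "level4 (a - e) (b - e) (c - e) (d - e) \<noteq> level4 a b c d"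
proof -
  have s: "a + b + c + d = 2 * e"
    using g by (simp only: generic4_def)
  then have s': "a - e + (b - e) + (c - e) + (d - e) = 2 * (-e)"
    by linarith
  have nz: "a \<noteq> 0" "b \<noteq> 0" "c \<noteq> 0" "d \<noteq> 0" "a \<noteq> e" "b \<noteq> e" "c \<noteq> e" "d \<noteq> e"
    "a + b \<noteq> e" "a + c \<noteq> e" "a + d \<noteq> e"
    using g by (simp_all add: generic4_def)
  have "int (level4 (a - e) (b - e) (c - e) (d - e)) \<noteq> int (level4 a b c d)"
    unfolding level4_formula[OF s] level4_formula[OF s'] of_bool_def
    using nz o s e by (smt (verit))
  then show ?thesis by simp
qed

section \<open>Roots and the Weyl group\<close>

text \<open>The factor 2 in the spanning condition is the norm of the elements of \<open>R0\<close>: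
  pairing with them forces the coefficients to be the products with the simple root, so integral
  coefficients lose nothing.\<close>

locale orthogonal_frame =
  fixes \<Gamma> :: diagram and R0 :: "vec set"
  assumes finite_nodes: "finite (nodes \<Gamma>)"
    and finite_R0: "finite R0"
    and R0_nonempty: "R0 \<noteq> {}"
    and R0_supported: "\<beta> \<in> R0 \<Longrightarrow> supported \<Gamma> \<beta>"
    and R0_nonneg: "\<beta> \<in> R0 \<Longrightarrow> 0 \<le> \<beta> i"
    and R0_norm: "\<beta> \<in> R0 \<Longrightarrow> form \<Gamma> \<beta> \<beta> = 2"
    and R0_orthogonal: "orthogonal_set \<Gamma> R0"
    and R0_spans: "i \<in> nodes \<Gamma> \<Longrightarrow> \<exists>f. \<forall>j. 2 * simple_root i j = (\<Sum>\<beta>\<in>R0. f \<beta> * \<beta> j)"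
begin

abbreviation B where "B \<equiv> form \<Gamma>"
abbreviation h where "h \<equiv> height \<Gamma>"
abbreviation refl where "refl \<equiv> reflection \<Gamma>"

text \<open>This set is closed under reflections and negation by computation alone, without the Weyl
  group; \<open>roots_eq_Phi\<close> identifies it with the roots.\<close>

definition Phi :: "vec set" where
  "Phi = {v. supported \<Gamma> v \<and> B v v = 2}"

lemma form_orthogonal_sum:
  assumes "finite A" "orthogonal_set \<Gamma> A" "\<And>\<beta>. \<beta> \<in> A \<Longrightarrow> B \<beta> \<beta> = 2" "\<gamma> \<in> A"
  shows "B (\<lambda>j. \<Sum>\<beta>\<in>A. f \<beta> * \<beta> j) \<gamma> = 2 * f \<gamma>"
proof -
  have "B (\<lambda>j. \<Sum>\<beta>\<in>A. f \<beta> * \<beta> j) \<gamma> = (\<Sum>\<beta>\<in>A. f \<beta> * B \<beta> \<gamma>)"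
    by (simp add: form_sum_left form_smult_left)
  also have "\<dots> = (\<Sum>\<beta>\<in>A. if \<beta> = \<gamma> then 2 * f \<gamma> else 0)"
    using assms by (intro sum.cong) (auto simp: orthogonal_set_def pairwise_def)
  finally show ?thesis
    using assms by simp
qed

lemma R0_expand_simple:
  assumes "i \<in> nodes \<Gamma>"
  shows "2 * simple_root i j = (\<Sum>\<beta>\<in>R0. B (simple_root i) \<beta> * \<beta> j)"
proof -
  obtain f where f: "\<And>j. 2 * simple_root i j = (\<Sum>\<beta>\<in>R0. f \<beta> * \<beta> j)"
    using R0_spans[OF assms] by blast
  have "f \<gamma> = B (simple_root i) \<gamma>" if "\<gamma> \<in> R0" for \<gamma>
  proof -
    have "2 * B (simple_root i) \<gamma> = B (\<lambda>j. 2 * simple_root i j) \<gamma>"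
      by (simp only: form_smult_left)
    also have "\<dots> = 2 * f \<gamma>"
      unfolding f using form_orthogonal_sum[OF finite_R0 R0_orthogonal R0_norm that] by simp
    finally show ?thesis by simp
  qed
  then show ?thesis
    using f by simp
qed

lemma supported_expand:
  assumes "supported \<Gamma> v"
  shows "v j = (\<Sum>i\<in>nodes \<Gamma>. v i * simple_root i j)"
proof -
  have "(\<Sum>i\<in>nodes \<Gamma>. v i * simple_root i j) = (\<Sum>i\<in>nodes \<Gamma>. if i = j then v j else 0)"
    by (intro sum.cong) (auto simp: simple_root_def)
  then show ?thesis
    using assms finite_nodes by (simp add: supported_def)
qed

lemma R0_expand:
  assumes "supported \<Gamma> v"
  shows "2 * v j = (\<Sum>\<beta>\<in>R0. B v \<beta> * \<beta> j)"
proof -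
  have "2 * v j = (\<Sum>i\<in>nodes \<Gamma>. v i * (2 * simple_root i j))"
    by (subst supported_expand[OF assms]) (simp add: sum_distrib_left mult.left_commute)
  also have "\<dots> = (\<Sum>i\<in>nodes \<Gamma>. \<Sum>\<beta>\<in>R0. v i * B (simple_root i) \<beta> * \<beta> j)"
    by (intro sum.cong) (simp_all add: R0_expand_simple sum_distrib_left mult.assoc)
  also have "\<dots> = (\<Sum>\<beta>\<in>R0. B v \<beta> * \<beta> j)"
    by (subst sum.swap) (simp add: form_expand_left[OF finite_nodes, of v] sum_distrib_right)
  finally show ?thesis .
qed

text \<open>Parseval's identity; it makes the form positive definite.\<close>

lemma R0_parseval:
  assumes "supported \<Gamma> v"
  shows "2 * B v w = (\<Sum>\<beta>\<in>R0. B v \<beta> * B w \<beta>)"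
proof -
  have "2 * B v w = B (\<lambda>j. 2 * v j) w"
    by (simp only: form_smult_left)
  also have "\<dots> = (\<Sum>\<beta>\<in>R0. B v \<beta> * B w \<beta>)"
    by (simp add: R0_expand[OF assms] form_sum_left form_smult_left form_commute[of \<Gamma> w])
  finally show ?thesis .
qed

lemma form_nonneg:
  assumes "supported \<Gamma> v"
  shows "B v v \<ge> 0"
proof -
  have "2 * B v v = (\<Sum>\<beta>\<in>R0. B v \<beta> * B v \<beta>)"
    using R0_parseval[OF assms] by simp
  also have "\<dots> \<ge> 0"
    by (intro sum_nonneg) simp
  finally show ?thesis by simp
qed

lemma form_definite:
  assumes "supported \<Gamma> v" "B v v \<le> 0"
  shows "v j = 0"
proof -
  have "(\<Sum>\<beta>\<in>R0. B v \<beta> * B v \<beta>) = 0"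
    using R0_parseval[OF assms(1), of v] form_nonneg[OF assms(1)] assms(2)
    by simp
  then have "\<forall>\<beta>\<in>R0. B v \<beta> = 0"
    using finite_R0 by (subst (asm) sum_nonneg_eq_0_iff) auto
  then show ?thesis
    using R0_expand[OF assms(1), of j] by simp
qed

lemma form_ge_2:
  assumes "supported \<Gamma> v" "v j \<noteq> 0"
  shows "B v v \<ge> 2"
proof -
  have "B v v > 0"
    using form_definite[OF assms(1)] assms(2) by force
  with even_form_self[OF finite_nodes, of v] show ?thesis
    by presburger
qed

section \<open>Vectors of norm 2: signs, products and heights\<close>

lemma simple_in_Phi: "i \<in> nodes \<Gamma> \<Longrightarrow> simple_root i \<in> Phi"
  by (auto simp: Phi_def supported_def form_simple_root_self finite_nodes) (auto simp: simple_root_def)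

lemma Phi_uminus: "v \<in> Phi \<Longrightarrow> (\<lambda>j. - v j) \<in> Phi"
  by (simp add: Phi_def supported_def form_linear)

lemma Phi_norm: "v \<in> Phi \<Longrightarrow> B v v = 2"
  by (simp add: Phi_def)

lemma Phi_supported: "v \<in> Phi \<Longrightarrow> supported \<Gamma> v"
  by (simp add: Phi_def)

lemma Phi_reflection:
  assumes "\<alpha> \<in> Phi" "v \<in> Phi"
  shows "refl \<alpha> v \<in> Phi"
proof -
  have "supported \<Gamma> (refl \<alpha> v)"
    using assms by (auto simp: Phi_def supported_def reflection_def)
  then show ?thesis
    using assms reflection_isometry[of \<Gamma> \<alpha> v v] by (simp add: Phi_def)
qed

text \<open>The positive and negative parts \<open>p\<close> and \<open>q\<close> have disjoint
  supports, and off-diagonal Cartan entries are at most 0, so \<open>B p q\<close> is at most 0. If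
  both parts were nonzero, the norm of \<open>p - q\<close> would be at least 2 + 2.\<close>

lemma Phi_sign:
  assumes "v \<in> Phi"
  shows "(\<forall>i. v i \<ge> 0) \<or> (\<forall>i. v i \<le> 0)"
proof (rule ccontr)
  assume "\<not> ?thesis"
  then obtain a b where a: "v a < 0" and b: "v b > 0"
    by (auto simp: not_le)
  define p where "p = (\<lambda>j. max (v j) 0)"
  define q where "q = (\<lambda>j. max (- v j) 0)"
  have v: "v = (\<lambda>j. p j - q j)"
    by (auto simp: p_def q_def fun_eq_iff)
  have sp: "supported \<Gamma> p" "supported \<Gamma> q"
    using Phi_supported[OF assms] by (auto simp: supported_def p_def q_def)
  have "B p q \<le> 0"
    unfolding form_def
  proof (intro sum_nonpos)
    fix i j
    show "p i * q j * cartan \<Gamma> i j \<le> 0"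
    proof (cases "i = j")
      case True
      then show ?thesis
        by (simp add: p_def q_def max_def)
    next
      case False
      then have "cartan \<Gamma> i j \<le> 0"
        by (simp add: cartan_def)
      then show ?thesis
        by (intro mult_nonneg_nonpos) (auto simp: p_def q_def)
    qed
  qed
  moreover have "B v v = B p p - 2 * B p q + B q q"
    unfolding v by (simp add: form_linear form_commute[of _ q p])
  moreover have "B p p \<ge> 2" "B q q \<ge> 2"
    using form_ge_2[OF sp(1), of b] form_ge_2[OF sp(2), of a] a b by (auto simp: p_def q_def)
  ultimately show False
    using Phi_norm[OF assms] by simp
qed

text \<open>The sum and the difference of two roots have norm \<open>4 + 2 * B u v\<close> and
  \<open>4 - 2 * B u v\<close>; these are nonnegative, and a vector of norm 0 vanishes.\<close>

lemma form_bounds: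
  assumes "u \<in> Phi" "v \<in> Phi"
  shows "-2 \<le> B u v" "B u v \<le> 2"
    and "B u v = 2 \<Longrightarrow> u = v" and "B u v = -2 \<Longrightarrow> u = (\<lambda>j. - v j)"
proof -
  have s: "supported \<Gamma> (\<lambda>j. u j - v j)" "supported \<Gamma> (\<lambda>j. u j + v j)"
    using assms by (auto simp: Phi_def supported_def)
  have n: "B (\<lambda>j. u j - v j) (\<lambda>j. u j - v j) = 4 - 2 * B u v"
    "B (\<lambda>j. u j + v j) (\<lambda>j. u j + v j) = 4 + 2 * B u v"
    using assms by (simp_all add: form_linear Phi_norm form_commute[of _ v u])
  show "-2 \<le> B u v" "B u v \<le> 2"
    using form_nonneg[OF s(1)] form_nonneg[OF s(2)] n by simp_all
  show "u = v" if "B u v = 2"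
    using form_definite[OF s(1)] n that by (simp add: fun_eq_iff)
  show "u = (\<lambda>j. - v j)" if "B u v = -2"
    using form_definite[OF s(2)] n that by (simp add: fun_eq_iff eq_neg_iff_add_eq_0)
qed

definition Pos :: "vec set" where
  "Pos = {v \<in> Phi. \<forall>i. 0 \<le> v i}"

lemma Pos_in_Phi: "v \<in> Pos \<Longrightarrow> v \<in> Phi"
  by (simp add: Pos_def)

lemma Pos_nonneg: "v \<in> Pos \<Longrightarrow> 0 \<le> v i"
  by (simp add: Pos_def)

lemma simple_in_Pos: "i \<in> nodes \<Gamma> \<Longrightarrow> simple_root i \<in> Pos"
  by (simp add: Pos_def simple_in_Phi) (simp add: simple_root_def)

lemma Phi_nonzero:
  assumes "v \<in> Phi"
  obtains i where "i \<in> nodes \<Gamma>" "v i \<noteq> 0"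
proof -
  have "v \<noteq> (\<lambda>_. 0)"
    using Phi_norm[OF assms] by (auto simp: form_def)
  then show ?thesis
    using that Phi_supported[OF assms] by (auto simp: fun_eq_iff supported_def)
qed

lemma Pos_height:
  assumes "v \<in> Pos"
  shows "h v > 0"
proof -
  obtain i where "i \<in> nodes \<Gamma>" "v i \<noteq> 0"
    using Phi_nonzero Pos_in_Phi[OF assms] by blast
  then show ?thesis
    using Pos_nonneg[OF assms] finite_nodes unfolding height_def
    by (intro sum_pos2[of _ i]) (auto simp: order.strict_iff_order)
qed

lemma Pos_or_uminus:
  assumes "v \<in> Phi"
  shows "v \<in> Pos \<or> (\<lambda>j. - v j) \<in> Pos"
  using assms Phi_sign[OF assms] Phi_uminus[OF assms] by (auto simp: Pos_def)

lemma height_uminus_Pos: "(\<lambda>j. - v j) \<in> Pos \<Longrightarrow> h v < 0"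
  using Pos_height[of "\<lambda>j. - v j"] by (simp add: height_linear)

lemma Pos_iff_height:
  assumes "v \<in> Phi"
  shows "v \<in> Pos \<longleftrightarrow> h v > 0"
  using Pos_or_uminus[OF assms] Pos_height height_uminus_Pos by fastforce

lemma height_nonzero: "v \<in> Phi \<Longrightarrow> h v \<noteq> 0"
  using Pos_or_uminus Pos_height height_uminus_Pos by fastforce

lemma height_simple: "i \<in> nodes \<Gamma> \<Longrightarrow> h (simple_root i) = 1"
  using finite_nodes by (simp add: height_def simple_root_def)

text \<open>A positive root other than the simple root has a positive coordinate at another node.
  The reflection does not touch that coordinate, and one positive coordinate decides the sign of a
  root.\<close>

lemma simple_reflection_Pos:
  assumes i: "i \<in> nodes \<Gamma>" and v: "v \<in> Pos" and ne: "v \<noteq> simple_root i"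
  shows "refl (simple_root i) v \<in> Pos"
proof -
  have P: "refl (simple_root i) v \<in> Phi"
    using assms Phi_reflection simple_in_Phi Pos_in_Phi by blast
  have "\<exists>j. j \<noteq> i \<and> v j \<noteq> 0"
  proof (rule ccontr)
    assume "\<not> ?thesis"
    then have v': "v = (\<lambda>j. v i * simple_root i j)"
      by (auto simp: fun_eq_iff simple_root_def)
    have "B v v = v i * (v i * 2)"
      using arg_cong2[OF v' v', of B]
      by (simp only: form_linear form_simple_root_self finite_nodes i mult.assoc)
    then have "v i * v i = 1"
      using v Phi_norm Pos_in_Phi by force
    then have "v i = 1"
      using Pos_nonneg[OF v, of i] by (simp add: zmult_eq_1_iff)
    with v' ne show False
      by simp
  qed
  then obtain j where "j \<noteq> i" "v j > 0"
    using Pos_nonneg[OF v] by (metis order_le_less)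
  then have "refl (simple_root i) v j > 0"
    by (simp add: reflection_def simple_root_def)
  then show ?thesis
    using Phi_sign[OF P] P by (auto simp: Pos_def) (meson linorder_not_less)
qed

text \<open>A class of maps closed under composition that contains all reflections, and hence the
  Weyl group; preservation of \<open>supported\<close> makes its members map \<open>Phi\<close> into
  itself.\<close>

definition Iso :: "(vec \<Rightarrow> vec) set" where
  "Iso = {w. (\<forall>u v c. w (\<lambda>j. u j + c * v j) = (\<lambda>j. w u j + c * w v j)) \<and>
     (\<forall>u v. B (w u) (w v) = B u v) \<and> (\<forall>v. supported \<Gamma> v \<longrightarrow> supported \<Gamma> (w v))}"

lemma Iso_linear: "w \<in> Iso \<Longrightarrow> w (\<lambda>j. u j + c * v j) = (\<lambda>j. w u j + c * w v j)"
  by (simp add: Iso_def)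

lemma Iso_form: "w \<in> Iso \<Longrightarrow> B (w u) (w v) = B u v"
  by (simp add: Iso_def)

lemma Iso_uminus:
  assumes "w \<in> Iso"
  shows "w (\<lambda>j. - v j) = (\<lambda>j. - w v j)"
  using Iso_linear[OF assms, of v "- 2" v] by simp

lemma Iso_Phi: "w \<in> Iso \<Longrightarrow> v \<in> Phi \<Longrightarrow> w v \<in> Phi"
  by (simp add: Iso_def Phi_def)

lemma Iso_reflection:
  assumes "w \<in> Iso"
  shows "w (refl \<alpha> v) = refl (w \<alpha>) (w v)"
  using Iso_linear[OF assms, of v "- B \<alpha> v" \<alpha>] Iso_form[OF assms] by (simp add: reflection_def)

lemma reflection_in_Iso: "\<alpha> \<in> Phi \<Longrightarrow> refl \<alpha> \<in> Iso"
  using reflection_isometry[of \<Gamma> \<alpha>] reflection_linear[of \<Gamma> \<alpha>]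
  by (auto simp: Iso_def Phi_def supported_def) (auto simp: reflection_def)

lemma Iso_comp: "v \<in> Iso \<Longrightarrow> w \<in> Iso \<Longrightarrow> v \<circ> w \<in> Iso"
  by (simp add: Iso_def)

lemma id_in_Iso: "id \<in> Iso"
  by (simp add: Iso_def)

section \<open>The Weyl group and its orbit of roots\<close>

abbreviation W where "W \<equiv> parabolic_subgroup (simple_reflections \<Gamma>)"

lemma W_carrier_def: "carrier W = generate (BijGroup UNIV) (simple_reflections \<Gamma>)"
  using simple_reflections_subset_BijGroup[OF finite_nodes]
  by (simp add: parabolic_subgroup_def carrier_subgroup_generated Int_absorb1)

lemma W_group: "group W"
  unfolding parabolic_subgroup_def using group.group_subgroup_generated[OF group_BijGroup] .

lemma W_subset_BijGroup: "carrier W \<subseteq> carrier (BijGroup UNIV)"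
  unfolding parabolic_subgroup_def by (rule group.carrier_subgroup_generated_subset[OF group_BijGroup])

lemma W_mult:
  assumes "v \<in> carrier W" "w \<in> carrier W"
  shows "v \<otimes>\<^bsub>W\<^esub> w = v \<circ> w"
proof -
  have "v \<in> Bij UNIV" "w \<in> Bij UNIV"
    using assms W_subset_BijGroup by (auto simp: BijGroup_def)
  then show ?thesis
    by (simp add: parabolic_subgroup_def BijGroup_def compose_def fun_eq_iff)
qed

lemma W_one: "\<one>\<^bsub>W\<^esub> = id"
  by (simp add: parabolic_subgroup_def BijGroup_def fun_eq_iff)

lemma id_in_W: "id \<in> carrier W"
  using monoid.one_closed[OF group.is_monoid[OF W_group]] by (simp add: W_one)

lemma comp_in_W: "v \<in> carrier W \<Longrightarrow> w \<in> carrier W \<Longrightarrow> v \<circ> w \<in> carrier W"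
  using monoid.m_closed[OF group.is_monoid[OF W_group]] W_mult by metis

lemma simple_in_W: "i \<in> nodes \<Gamma> \<Longrightarrow> refl (simple_root i) \<in> carrier W"
  unfolding W_carrier_def by (intro generate.incl) (simp add: simple_reflections_def)

lemma reflection_involution: "\<alpha> \<in> Phi \<Longrightarrow> refl \<alpha> (refl \<alpha> v) = v"
  by (rule reflection_reflection) (rule Phi_norm)

lemma BijGroup_mult:
  assumes "v \<in> carrier (BijGroup UNIV)" "w \<in> carrier (BijGroup UNIV)"
  shows "v \<otimes>\<^bsub>BijGroup UNIV\<^esub> w = v \<circ> w"
  using assms by (simp add: BijGroup_def compose_def fun_eq_iff)

lemma BijGroup_one: "\<one>\<^bsub>BijGroup UNIV\<^esub> = id"
  by (simp add: BijGroup_def fun_eq_iff)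

lemma W_in_Iso:
  assumes "w \<in> carrier W"
  shows "w \<in> Iso"
  using assms unfolding W_carrier_def
proof (induction rule: generate.induct)
  case one
  then show ?case
    using id_in_Iso by (simp add: BijGroup_one id_def)
next
  case (incl s)
  then show ?case
    by (auto simp: simple_reflections_def intro: reflection_in_Iso simple_in_Phi)
next
  case (inv s)
  then obtain i where i: "i \<in> nodes \<Gamma>" "s = refl (simple_root i)"
    by (auto simp: simple_reflections_def)
  have s: "s \<in> carrier (BijGroup UNIV)"
    using inv simple_reflections_subset_BijGroup[OF finite_nodes] by blast
  have "s \<circ> s = id"
    unfolding i(2) by (simp add: o_def id_def reflection_involution simple_in_Phi i(1))
  then have "inv\<^bsub>BijGroup UNIV\<^esub> s = s"
    by (intro group.inv_equality[OF group_BijGroup _ s s]) (simp add: BijGroup_mult s BijGroup_one)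
  then show ?case
    using i by (simp add: reflection_in_Iso simple_in_Phi)
next
  case (eng v w)
  then have "v \<in> carrier (BijGroup UNIV)" "w \<in> carrier (BijGroup UNIV)"
    using W_subset_BijGroup unfolding W_carrier_def by blast+
  then show ?case
    using Iso_comp[OF eng.IH] by (simp add: BijGroup_mult o_def)
qed

text \<open>As \<open>B v v\<close> is positive and expands along the simple roots, some simple root
  has positive product with \<open>v\<close>; reflecting in it lowers the height.\<close>

lemma Pos_conjugate_simple:
  assumes "v \<in> Pos"
  shows "\<exists>w\<in>carrier W. \<exists>i\<in>nodes \<Gamma>. v = w (simple_root i)"
  using assms
proof (induction "nat (h v)" arbitrary: v rule: less_induct)
  case less
  have v: "v \<in> Phi" "v \<in> Pos"
    using less.prems Pos_in_Phi by auto
  have "(\<Sum>i\<in>nodes \<Gamma>. v i * B (simple_root i) v) > 0"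
    using form_expand_left[OF finite_nodes, of v v] Phi_norm[OF v(1)] by simp
  then obtain i where i: "i \<in> nodes \<Gamma>" "v i * B (simple_root i) v > 0"
    by (meson not_less sum_nonpos)
  then have b: "B (simple_root i) v > 0"
    using Pos_nonneg[OF v(2), of i] by (simp add: zero_less_mult_iff)
  show ?case
  proof (cases "v = simple_root i")
    case True
    then show ?thesis
      using i id_in_W by (intro bexI[of _ id] bexI[of _ i]) auto
  next
    case False
    define u where "u = refl (simple_root i) v"
    have u: "u \<in> Pos"
      unfolding u_def by (rule simple_reflection_Pos[OF i(1) v(2) False])
    have "h u < h v"
      using b i(1) by (simp add: u_def reflection_def height_linear height_simple)
    then obtain w j where w: "w \<in> carrier W" "j \<in> nodes \<Gamma>" "u = w (simple_root j)"
      using less.hyps[OF _ u] Pos_height[OF u] by auto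
    have "v = refl (simple_root i) u"
      unfolding u_def by (simp add: reflection_involution simple_in_Phi i(1))
    then have "v = (refl (simple_root i) \<circ> w) (simple_root j)"
      using w by simp
    moreover have "refl (simple_root i) \<circ> w \<in> carrier W"
      using w simple_in_W[OF i(1)] comp_in_W by blast
    ultimately show ?thesis
      using w(2) by blast
  qed
qed

lemma roots_eq_Phi: "roots \<Gamma> = Phi"
proof (intro equalityI subsetI)
  fix v
  assume "v \<in> roots \<Gamma>"
  then show "v \<in> Phi"
    by (auto simp: roots_def weyl_group_def intro: Iso_Phi W_in_Iso simple_in_Phi)
next
  fix v
  assume v: "v \<in> Phi"
  show "v \<in> roots \<Gamma>"
  proof (cases "v \<in> Pos")
    case True
    then show ?thesis
      using Pos_conjugate_simple[OF True] by (auto simp: roots_def weyl_group_def)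
  next
    case False
    then obtain w i where w: "w \<in> carrier W" "i \<in> nodes \<Gamma>" "(\<lambda>j. - v j) = w (simple_root i)"
      using Pos_or_uminus[OF v] Pos_conjugate_simple by blast
    have "refl (simple_root i) (simple_root i) = (\<lambda>j. - simple_root i j)"
      by (simp add: reflection_def form_simple_root_self finite_nodes w(2) fun_eq_iff)
    then have "w (refl (simple_root i) (simple_root i)) = (\<lambda>j. - w (simple_root i) j)"
      by (simp only: Iso_uminus[OF W_in_Iso[OF w(1)]])
    also have "\<dots> = v"
      unfolding w(3)[symmetric] by simp
    finally have "v = (w \<circ> refl (simple_root i)) (simple_root i)"
      by simp
    moreover have "w \<circ> refl (simple_root i) \<in> carrier W"
      using w simple_in_W comp_in_W by blast
    ultimately show ?thesis
      using w(2) unfolding roots_def weyl_group_def by blast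
  qed
qed

lemma positive_roots_eq_Pos: "positive_roots \<Gamma> = Pos"
  by (simp add: positive_roots_def Pos_def roots_eq_Phi)

lemma finite_Phi: "finite Phi"
proof -
  \<comment> \<open>\<open>F\<close> rebuilds a root from its products with \<open>R0\<close>, of
    which there are finitely many possibilities.\<close>
  define F where "F = (\<lambda>f j. (\<Sum>\<beta>\<in>R0. f \<beta> * \<beta> j) div 2 :: int)"
  have R0: "R0 \<subseteq> Phi"
    using R0_supported R0_norm by (auto simp: Phi_def)
  have "v \<in> F ` (R0 \<rightarrow>\<^sub>E {-2..2})" if "v \<in> Phi" for v
  proof (rule image_eqI)
    show "restrict (B v) R0 \<in> R0 \<rightarrow>\<^sub>E {-2..2}"
      using form_bounds(1,2)[OF that] R0 by (auto simp: PiE_def)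
    show "v = F (restrict (B v) R0)"
      using R0_expand[OF Phi_supported[OF that], symmetric] by (simp add: F_def fun_eq_iff)
  qed
  then have "Phi \<subseteq> F ` (R0 \<rightarrow>\<^sub>E {-2..2})"
    by blast
  then show ?thesis
    using finite_R0 by (meson finite_PiE finite_atLeastAtMost_int finite_imageI finite_subset)
qed

section \<open>Maximal orthogonal sets\<close>

lemma orthogonalD: "orthogonal_set \<Gamma> R \<Longrightarrow> \<beta> \<in> R \<Longrightarrow> \<gamma> \<in> R \<Longrightarrow> \<beta> \<noteq> \<gamma> \<Longrightarrow> B \<beta> \<gamma> = 0"
  by (auto simp: orthogonal_set_def pairwise_def)

text \<open>The vector \<open>u\<close> is twice the component of \<open>v\<close> orthogonal to
  \<open>R\<close>, and its norm is twice the defect of the inequality.\<close>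

lemma bessel:
  assumes R: "R \<subseteq> Phi" "orthogonal_set \<Gamma> R" and v: "supported \<Gamma> v"
  shows "(\<Sum>\<gamma>\<in>R. (B v \<gamma>)\<^sup>2) \<le> 2 * B v v"
    and "(\<Sum>\<gamma>\<in>R. (B v \<gamma>)\<^sup>2) = 2 * B v v \<Longrightarrow> 2 * v j = (\<Sum>\<gamma>\<in>R. B v \<gamma> * \<gamma> j)"
proof -
  have fin: "finite R"
    using R(1) finite_Phi finite_subset by blast
  define p where "p = (\<lambda>j. \<Sum>\<gamma>\<in>R. B v \<gamma> * \<gamma> j)"
  define u where "u = (\<lambda>j. 2 * v j - p j)"
  have p: "B p w = (\<Sum>\<gamma>\<in>R. B v \<gamma> * B \<gamma> w)" for w
    by (simp add: p_def form_sum_left form_smult_left)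
  have "B \<gamma> p = 2 * B v \<gamma>" if "\<gamma> \<in> R" for \<gamma>
    unfolding p_def form_commute[of \<Gamma> \<gamma>]
    using R that by (intro form_orthogonal_sum[OF fin]) (auto simp: Phi_def)
  then have "B p p = 2 * (\<Sum>\<gamma>\<in>R. (B v \<gamma>)\<^sup>2)"
    by (simp add: p[of p] sum_distrib_left power2_eq_square mult.left_commute)
  moreover have "B v p = (\<Sum>\<gamma>\<in>R. (B v \<gamma>)\<^sup>2)"
    unfolding form_commute[of \<Gamma> v p] p
    by (intro sum.cong refl) (metis form_commute power2_eq_square)
  ultimately have u: "B u u = 4 * B v v - 2 * (\<Sum>\<gamma>\<in>R. (B v \<gamma>)\<^sup>2)"
    by (simp add: u_def form_linear form_commute[of \<Gamma> p v])
  have s: "supported \<Gamma> u"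
    using R(1) v by (auto simp: u_def p_def supported_def Phi_def intro!: sum.neutral)
  show "(\<Sum>\<gamma>\<in>R. (B v \<gamma>)\<^sup>2) \<le> 2 * B v v"
    using form_nonneg[OF s] u by simp
  show "2 * v j = (\<Sum>\<gamma>\<in>R. B v \<gamma> * \<gamma> j)" if "(\<Sum>\<gamma>\<in>R. (B v \<gamma>)\<^sup>2) = 2 * B v v"
    using form_definite[OF s, of j] u that by (simp add: u_def p_def)
qed

lemma R0_subset_Pos: "R0 \<subseteq> Pos"
  using R0_supported R0_norm R0_nonneg by (auto simp: Pos_def Phi_def)

text \<open>Parseval's identity for \<open>R0\<close> gives 4 for each \<gamma>. Bessel's inequality
  for \<open>R\<close> bounds the same double sum by 4 for each \<beta> in \<open>R0\<close>, which
  compares the cardinalities.\<close>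

lemma double_count:
  assumes R: "R \<subseteq> Phi"
  shows "(\<Sum>\<beta>\<in>R0. \<Sum>\<gamma>\<in>R. (B \<beta> \<gamma>)\<^sup>2) = 4 * int (card R)"
proof -
  have "(\<Sum>\<beta>\<in>R0. (B \<beta> \<gamma>)\<^sup>2) = 4" if "\<gamma> \<in> R" for \<gamma>
  proof -
    have "\<gamma> \<in> Phi"
      using that R by blast
    moreover have "(B \<beta> \<gamma>)\<^sup>2 = B \<gamma> \<beta> * B \<gamma> \<beta>" for \<beta>
      by (simp add: power2_eq_square form_commute[of \<Gamma> \<beta> \<gamma>])
    ultimately show ?thesis
      using R0_parseval[of \<gamma> \<gamma>] by (simp add: Phi_def)
  qed
  then show ?thesis
    by (subst sum.swap) simp
qed

lemma card_orthogonal_le: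
  assumes R: "R \<subseteq> Phi" "orthogonal_set \<Gamma> R"
  shows "card R \<le> card R0"
proof -
  have "(\<Sum>\<beta>\<in>R0. \<Sum>\<gamma>\<in>R. (B \<beta> \<gamma>)\<^sup>2) \<le> (\<Sum>\<beta>\<in>R0. 4)"
    using bessel(1)[OF R] by (intro sum_mono) (metis R0_norm R0_supported mult_2 numeral_Bit0)
  then show ?thesis
    using double_count[OF R(1)] by simp
qed

abbreviation Om where "Om \<equiv> Omega \<Gamma> (positive_roots \<Gamma>)"

lemma kappa_eq: "kappa \<Gamma> Pos = card R0"
proof -
  have le: "card R \<le> card R0" if "R \<subseteq> Pos" "orthogonal_set \<Gamma> R" for R
    using card_orthogonal_le that Pos_in_Phi by (meson subset_iff)
  show ?thesis
    unfolding kappa_def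
  proof (rule Max_eqI)
    show "finite {card R |R. R \<subseteq> Pos \<and> orthogonal_set \<Gamma> R}"
      by (rule finite_subset[of _ "{..card R0}"]) (auto simp: le)
    show "card R0 \<in> {card R |R. R \<subseteq> Pos \<and> orthogonal_set \<Gamma> R}"
      using R0_subset_Pos R0_orthogonal by blast
  qed (auto simp: le)
qed

lemma Om_iff: "R \<in> Om \<longleftrightarrow> R \<subseteq> Pos \<and> orthogonal_set \<Gamma> R \<and> card R = card R0"
  by (simp add: Omega_def positive_roots_eq_Pos kappa_eq)

lemma Om_Pos: "R \<in> Om \<Longrightarrow> \<beta> \<in> R \<Longrightarrow> \<beta> \<in> Pos"
  by (auto simp: Om_iff)

lemma Om_Phi: "R \<in> Om \<Longrightarrow> \<beta> \<in> R \<Longrightarrow> \<beta> \<in> Phi"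
  by (auto simp: Om_iff Pos_in_Phi)

lemma Om_finite: "R \<in> Om \<Longrightarrow> finite R"
  using finite_Phi Om_Phi by (metis finite_subset subsetI)

lemma Om_orthogonal: "R \<in> Om \<Longrightarrow> \<beta> \<in> R \<Longrightarrow> \<gamma> \<in> R \<Longrightarrow> \<beta> \<noteq> \<gamma> \<Longrightarrow> B \<beta> \<gamma> = 0"
  by (auto simp: Om_iff intro: orthogonalD)

text \<open>As \<open>R\<close> has the size of \<open>R0\<close>, the double count attains its
  bound, so Bessel's inequality is an equality for every element of \<open>R0\<close>. Hence
  \<open>R0\<close>, and with it every supported vector, lies in the span of
  \<open>R\<close>.\<close>

lemma Om_expand:
  assumes R: "R \<in> Om" and v: "supported \<Gamma> v"
  shows "2 * v j = (\<Sum>\<gamma>\<in>R. B v \<gamma> * \<gamma> j)"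
proof -
  have R': "R \<subseteq> Phi" "orthogonal_set \<Gamma> R" "card R = card R0"
    using R Om_Phi by (auto simp: Om_iff)
  have "(\<Sum>\<gamma>\<in>R. (B \<beta> \<gamma>)\<^sup>2) = 4" if "\<beta> \<in> R0" for \<beta>
  proof (rule sum_mono_inv[of "\<lambda>\<beta>. \<Sum>\<gamma>\<in>R. (B \<beta> \<gamma>)\<^sup>2" R0 "\<lambda>_. 4"])
    show "(\<Sum>\<beta>\<in>R0. \<Sum>\<gamma>\<in>R. (B \<beta> \<gamma>)\<^sup>2) = (\<Sum>\<beta>\<in>R0. 4)"
      using double_count[OF R'(1)] R'(3) by simp
    show "(\<Sum>\<gamma>\<in>R. (B \<beta> \<gamma>)\<^sup>2) \<le> 4" if "\<beta> \<in> R0" for \<beta>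
      using bessel(1)[OF R'(1,2) R0_supported[OF that]] R0_norm[OF that] by simp
  qed (use that finite_R0 in auto)
  then have \<beta>: "2 * \<beta> j = (\<Sum>\<gamma>\<in>R. B \<beta> \<gamma> * \<gamma> j)" if "\<beta> \<in> R0" for \<beta>
    using bessel(2)[OF R'(1,2) R0_supported[OF that]] R0_norm[OF that] that by simp
  \<comment> \<open>Expansion along \<open>R0\<close>, then of each element of \<open>R0\<close>
    along \<open>R\<close>; Parseval's identity for \<open>R0\<close> recombines the
    coefficients.\<close>
  have "4 * v j = (\<Sum>\<beta>\<in>R0. B v \<beta> * (2 * \<beta> j))"
    using R0_expand[OF v, of j] by (simp add: sum_distrib_left mult.left_commute flip: sum_distrib_left)
  also have "\<dots> = (\<Sum>\<beta>\<in>R0. \<Sum>\<gamma>\<in>R. B v \<beta> * B \<gamma> \<beta> * \<gamma> j)"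
  proof (intro sum.cong refl)
    fix b
    assume "b \<in> R0"
    then show "B v b * (2 * b j) = (\<Sum>\<gamma>\<in>R. B v b * B \<gamma> b * \<gamma> j)"
      unfolding \<beta>[OF \<open>b \<in> R0\<close>] sum_distrib_left
      by (intro sum.cong refl) (metis form_commute mult.assoc)
  qed
  also have "\<dots> = (\<Sum>\<gamma>\<in>R. 2 * B v \<gamma> * \<gamma> j)"
    by (subst sum.swap) (simp add: R0_parseval[OF v] sum_distrib_right)
  finally show ?thesis
    by (simp add: sum_distrib_left mult.assoc flip: sum_distrib_left)
qed

lemma Om_parseval:
  assumes "R \<in> Om" "supported \<Gamma> v"
  shows "2 * B v w = (\<Sum>\<gamma>\<in>R. B v \<gamma> * B w \<gamma>)"
proof -
  have "2 * B v w = B (\<lambda>j. 2 * v j) w"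
    by (simp only: form_smult_left)
  also have "\<dots> = (\<Sum>\<gamma>\<in>R. B v \<gamma> * B w \<gamma>)"
    by (simp add: Om_expand[OF assms] form_sum_left form_smult_left form_commute[of \<Gamma> w])
  finally show ?thesis .
qed

text \<open>For a root outside \<plusminus>R this is its quadruple.\<close>

definition supp :: "vec set \<Rightarrow> vec \<Rightarrow> vec set" where
  "supp R \<gamma> = {\<beta> \<in> R. B \<gamma> \<beta> \<noteq> 0}"

text \<open>The squares of the products with \<open>R\<close> sum to 4, and outside \<plusminus>R
  the products \<plusminus>2 are excluded.\<close>

lemma supp_cases:
  assumes R: "R \<in> Om" and g: "\<gamma> \<in> Phi"
  shows "\<gamma> \<in> R \<or> (\<lambda>j. - \<gamma> j) \<in> R \<or> card (supp R \<gamma>) = 4 \<and> (\<forall>\<beta>\<in>supp R \<gamma>. B \<gamma> \<beta> = 1 \<or> B \<gamma> \<beta> = -1)"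
proof (cases "\<gamma> \<in> R \<or> (\<lambda>j. - \<gamma> j) \<in> R")
  case False
  have 1: "B \<gamma> \<beta> = 0 \<or> B \<gamma> \<beta> = 1 \<or> B \<gamma> \<beta> = -1" if "\<beta> \<in> R" for \<beta>
  proof -
    have "B \<gamma> \<beta> \<noteq> 2" "B \<gamma> \<beta> \<noteq> -2"
      using form_bounds(3,4)[OF g Om_Phi[OF R that]] False that by auto
    then show ?thesis
      using form_bounds(1,2)[OF g Om_Phi[OF R that]] by linarith
  qed
  have "(\<Sum>\<beta>\<in>R. B \<gamma> \<beta> * B \<gamma> \<beta>) = 4"
    using Om_parseval[OF R Phi_supported[OF g], of \<gamma>] Phi_norm[OF g] by simp
  also have "(\<Sum>\<beta>\<in>R. B \<gamma> \<beta> * B \<gamma> \<beta>) = (\<Sum>\<beta>\<in>R. of_bool (B \<gamma> \<beta> \<noteq> 0))"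
    using 1 by (intro sum.cong) force+
  also have "\<dots> = int (card (supp R \<gamma>))"
    using Om_finite[OF R] by (simp add: supp_def Int_def)
  finally show ?thesis
    using 1 by (auto simp: supp_def)
qed auto

text \<open>Membership in \<plusminus>R can be tested modulo 2; \<open>three_quadruples\<close> uses
  this in place of explicit half-sums.\<close>

lemma even_form_imp_mem:
  assumes "R \<in> Om" "\<gamma> \<in> Phi" "\<And>\<beta>. \<beta> \<in> R \<Longrightarrow> even (B \<gamma> \<beta>)"
  shows "\<gamma> \<in> R \<or> (\<lambda>j. - \<gamma> j) \<in> R"
proof (rule ccontr)
  assume "\<not> ?thesis"
  then have s: "card (supp R \<gamma>) = 4" "\<forall>\<beta>\<in>supp R \<gamma>. B \<gamma> \<beta> = 1 \<or> B \<gamma> \<beta> = -1"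
    using supp_cases[OF assms(1,2)] by auto
  then obtain \<beta> where "\<beta> \<in> supp R \<gamma>"
    by fastforce
  then show False
    using s(2) assms(3)[of \<beta>] by (auto simp: supp_def)
qed

section \<open>The standard action on maximal orthogonal sets\<close>

lemma abs_root_eq: "abs_root \<Gamma> v = (if v \<in> Pos then v else (\<lambda>j. - v j))"
  by (simp add: abs_root_def positive_roots_eq_Pos)

lemma abs_root_cases: "abs_root \<Gamma> v = v \<or> abs_root \<Gamma> v = (\<lambda>j. - v j)"
  by (simp add: abs_root_eq)

lemma abs_root_Pos: "v \<in> Phi \<Longrightarrow> abs_root \<Gamma> v \<in> Pos"
  using Pos_or_uminus by (auto simp: abs_root_eq)

lemma abs_root_id: "v \<in> Pos \<Longrightarrow> abs_root \<Gamma> v = v"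
  by (simp add: abs_root_eq)

lemma uminus_Pos: "v \<in> Pos \<Longrightarrow> (\<lambda>j. - v j) \<notin> Pos"
  using Pos_height height_uminus_Pos by fastforce

lemma abs_root_uminus: "v \<in> Phi \<Longrightarrow> abs_root \<Gamma> (\<lambda>j. - v j) = abs_root \<Gamma> v"
  using Pos_or_uminus[of v] uminus_Pos[of v] by (auto simp: abs_root_eq)

text \<open>A sign passes through a linear map and is discarded at the end, so the standard action
  respects composition.\<close>

lemma abs_root_Iso:
  assumes "w \<in> Iso" "v \<in> Phi"
  shows "abs_root \<Gamma> (w (abs_root \<Gamma> v)) = abs_root \<Gamma> (w v)"
  using abs_root_cases[of v] abs_root_uminus[OF Iso_Phi[OF assms]]
  by (auto simp: Iso_uminus[OF assms(1)])

lemma form_abs_root_zero_iff: "B (abs_root \<Gamma> u) v = 0 \<longleftrightarrow> B u v = 0"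
  "B v (abs_root \<Gamma> u) = 0 \<longleftrightarrow> B v u = 0"
  using abs_root_cases[of u] by (auto simp: form_linear)

lemma reflection_abs_root: "refl (abs_root \<Gamma> u) = refl u"
  using abs_root_cases[of u] by (auto simp: reflection_uminus_left)

abbreviation act where "act \<equiv> standard_action \<Gamma>"

lemma act_comp:
  assumes "v \<in> Iso" "w \<in> Iso" "R \<subseteq> Phi"
  shows "act v (act w R) = act (v \<circ> w) R"
  unfolding standard_action_def image_image
  using assms by (intro image_cong refl) (auto simp: abs_root_Iso Iso_Phi)

lemma act_inj:
  assumes "w \<in> Iso" "R \<in> Om"
  shows "inj_on (\<lambda>\<alpha>. abs_root \<Gamma> (w \<alpha>)) R"
proof (rule inj_onI, rule ccontr)
  fix a b
  assume ab: "a \<in> R" "b \<in> R" "abs_root \<Gamma> (w a) = abs_root \<Gamma> (w b)" "a \<noteq> b"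
  have "B (abs_root \<Gamma> (w a)) (abs_root \<Gamma> (w b)) = 0"
    using Om_orthogonal[OF assms(2) ab(1,2,4)] Iso_form[OF assms(1)] by (simp add: form_abs_root_zero_iff)
  moreover have "abs_root \<Gamma> (w b) \<in> Phi"
    using Pos_in_Phi[OF abs_root_Pos] Iso_Phi[OF assms(1)] Om_Phi[OF assms(2)] ab(2) by blast
  ultimately show False
    using ab(3) Phi_norm by fastforce
qed

lemma act_Om:
  assumes w: "w \<in> Iso" and R: "R \<in> Om"
  shows "act w R \<in> Om"
  unfolding Om_iff
proof (intro conjI)
  show "act w R \<subseteq> Pos"
    using Om_Phi[OF R] Iso_Phi[OF w] abs_root_Pos by (auto simp: standard_action_def)
  show "card (act w R) = card R0"
    using R card_image[OF act_inj[OF w R]] by (simp add: standard_action_def Om_iff)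
  show "orthogonal_set \<Gamma> (act w R)"
    using Om_orthogonal[OF R] Iso_form[OF w]
    by (auto simp: orthogonal_set_def pairwise_def standard_action_def form_abs_root_zero_iff)
qed

lemma Om_subset_Phi: "R \<in> Om \<Longrightarrow> R \<subseteq> Phi"
  using Om_Phi by blast

lemma act_id: "R \<subseteq> Pos \<Longrightarrow> act id R = R"
  by (force simp: standard_action_def abs_root_id)

lemma act_reflection_involution:
  assumes "\<alpha> \<in> Phi" "R \<subseteq> Pos"
  shows "act (refl \<alpha>) (act (refl \<alpha>) R) = R"
proof -
  have "refl \<alpha> \<circ> refl \<alpha> = id"
    by (simp add: o_def id_def reflection_involution assms(1))
  moreover have "R \<subseteq> Phi"
    using assms(2) Pos_in_Phi by blast
  ultimately show ?thesis
    using act_comp[of "refl \<alpha>" "refl \<alpha>" R] act_id[OF assms(2)] reflection_in_Iso[OF assms(1)] by simp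
qed

lemma act_conjugate:
  assumes w: "w \<in> Iso" and a: "\<alpha> \<in> Phi" and R: "R \<subseteq> Phi"
  shows "act w (act (refl \<alpha>) R) = act (refl (w \<alpha>)) (act w R)"
proof -
  have "w \<circ> refl \<alpha> = refl (w \<alpha>) \<circ> w"
    by (simp add: fun_eq_iff Iso_reflection[OF w])
  then show ?thesis
    using act_comp[OF w reflection_in_Iso[OF a] R] act_comp[OF reflection_in_Iso[OF Iso_Phi[OF w a]] w R]
    by simp
qed

lemma supp_act:
  assumes "w \<in> Iso"
  shows "supp (act w R) (w \<gamma>) = act w (supp R \<gamma>)"
  by (auto simp: supp_def standard_action_def form_abs_root_zero_iff Iso_form[OF assms])

lemma supp_uminus: "supp R (\<lambda>j. - \<gamma> j) = supp R \<gamma>"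
  by (simp add: supp_def form_linear)

lemma supp_subset: "supp R \<gamma> \<subseteq> R"
  by (auto simp: supp_def)

lemma supp_Pos: "R \<in> Om \<Longrightarrow> supp R \<gamma> \<subseteq> Pos"
  using supp_subset[of R \<gamma>] Om_Pos[of R] by blast

text \<open>Only the product with \<beta> changes, and only in sign. Hence all roots tested for the
  membership of \<gamma> in \<open>Res\<close> have the support of \<gamma>, and \<open>Res\<close>
  can be counted support by support.\<close>

lemma supp_reflection:
  assumes "R \<in> Om" "\<beta> \<in> R"
  shows "supp R (refl \<beta> \<gamma>) = supp R \<gamma>"
proof -
  have "B (refl \<beta> \<gamma>) \<delta> = (if \<delta> = \<beta> then - B \<gamma> \<delta> else B \<gamma> \<delta>)" if "\<delta> \<in> R" for \<delta>
    using Om_orthogonal[OF assms that] Phi_norm[OF Om_Phi[OF assms]] form_commute[of \<Gamma> \<beta> \<gamma>]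
    by (auto simp: reflection_def form_linear)
  then show ?thesis
    by (auto simp: supp_def split: if_splits)
qed

section \<open>Residual roots and the effect of a simple reflection\<close>

abbreviation Rs where "Rs \<equiv> Res \<Gamma> (positive_roots \<Gamma>)"
abbreviation rh where "rh \<equiv> rho \<Gamma> (positive_roots \<Gamma>)"

lemma Rs_iff: "\<gamma> \<in> Rs R \<longleftrightarrow> \<gamma> \<in> Pos \<and> (\<forall>\<beta>\<in>R. refl \<beta> \<gamma> \<in> Pos)"
  by (simp add: Res_def positive_roots_eq_Pos)

lemma finite_Rs: "finite (Rs R)"
  by (rule finite_subset[OF _ finite_Phi]) (auto simp: Rs_iff Pos_in_Phi)

definition Rq :: "vec set \<Rightarrow> vec set \<Rightarrow> vec set" where
  "Rq R Q = {\<gamma> \<in> Rs R. supp R \<gamma> = Q}"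

text \<open>The local level, indexed by a root instead of its quadruple, so that a simple reflection
  can move \<open>R\<close> and \<alpha> together.\<close>

definition lev :: "vec set \<Rightarrow> vec \<Rightarrow> nat" where
  "lev R \<alpha> = card (Rq R (supp R \<alpha>))"

lemma act_fixed:
  assumes R: "R \<in> Om" and a: "\<alpha> \<in> R \<or> (\<lambda>j. - \<alpha> j) \<in> R"
  shows "act (refl \<alpha>) R = R"
proof -
  have *: "act (refl \<alpha>) R = R" if "\<alpha> \<in> R" for \<alpha>
  proof -
    have "abs_root \<Gamma> (refl \<alpha> \<beta>) = \<beta>" if "\<beta> \<in> R" for \<beta>
    proof (cases "\<beta> = \<alpha>")
      case True
      have "refl \<alpha> \<alpha> = (\<lambda>j. - \<alpha> j)"
        using Phi_norm[OF Om_Phi[OF R \<open>\<alpha> \<in> R\<close>]] by (simp add: reflection_def)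
      then show ?thesis
        using True abs_root_uminus[OF Om_Phi[OF R that]] abs_root_id[OF Om_Pos[OF R that]] by simp
    next
      case False
      then have "refl \<alpha> \<beta> = \<beta>"
        using Om_orthogonal[OF R \<open>\<alpha> \<in> R\<close> that] by (simp add: reflection_def)
      then show ?thesis
        using abs_root_id[OF Om_Pos[OF R that]] by simp
    qed
    then show ?thesis
      by (simp add: standard_action_def)
  qed
  show ?thesis
    using a *[of \<alpha>] *[of "\<lambda>j. - \<alpha> j"] by (auto simp: reflection_uminus_left)
qed

abbreviation sr where "sr i \<equiv> refl (simple_root i)"

lemma simple_Iso: "i \<in> nodes \<Gamma> \<Longrightarrow> sr i \<in> Iso"
  by (simp add: reflection_in_Iso simple_in_Phi)

lemma simple_self: "i \<in> nodes \<Gamma> \<Longrightarrow> sr i (simple_root i) = (\<lambda>j. - simple_root i j)"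
  by (simp add: reflection_def form_simple_root_self finite_nodes fun_eq_iff)

lemma act_simple_image:
  assumes "i \<in> nodes \<Gamma>" "R \<in> Om" "simple_root i \<notin> R"
  shows "act (sr i) R = sr i ` R"
  unfolding standard_action_def
  using assms by (intro image_cong refl abs_root_id) (metis Om_Pos simple_reflection_Pos)

lemma simple_not_in_act:
  assumes i: "i \<in> nodes \<Gamma>" and R: "R \<in> Om" and n: "simple_root i \<notin> R"
  shows "simple_root i \<notin> act (sr i) R"
proof
  assume "simple_root i \<in> act (sr i) R"
  then obtain \<beta> where b: "\<beta> \<in> R" "simple_root i = sr i \<beta>"
    using act_simple_image[OF assms] by auto
  then have "\<beta> = sr i (simple_root i)"
    by (metis reflection_involution simple_in_Phi i)
  then show False
    using b(1) Om_Pos[OF R] uminus_Pos[OF simple_in_Pos[OF i]] simple_self[OF i] by metis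
qed

text \<open>The roots \<gamma> and \<open>refl \<beta> \<gamma>\<close> all have the support of
  \<gamma>. As this is not the support of the simple root, none of them is the simple root, and its
  reflection keeps them all positive.\<close>

lemma Rq_step:
  assumes i: "i \<in> nodes \<Gamma>" and R: "R \<in> Om" and n: "simple_root i \<notin> R"
    and g: "\<gamma> \<in> Rs R" and s: "supp R \<gamma> \<noteq> supp R (simple_root i)"
  shows "sr i \<gamma> \<in> Rs (act (sr i) R)"
proof -
  have "refl (sr i \<beta>) (sr i \<gamma>) \<in> Pos" if "\<beta> \<in> R" for \<beta>
  proof -
    have "refl \<beta> \<gamma> \<noteq> simple_root i"
      using s supp_reflection[OF R that, of \<gamma>] by metis
    then have "sr i (refl \<beta> \<gamma>) \<in> Pos"
      using g that simple_reflection_Pos[OF i] by (auto simp: Rs_iff)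
    then show ?thesis
      by (simp add: Iso_reflection[OF simple_Iso[OF i]])
  qed
  moreover have "sr i \<gamma> \<in> Pos"
    using g s simple_reflection_Pos[OF i, of \<gamma>] by (auto simp: Rs_iff)
  ultimately show ?thesis
    by (auto simp: Rs_iff act_simple_image[OF i R n])
qed

text \<open>The predicate serves two purposes: \<open>lev_invariant\<close> selects one support,
  \<open>rh_step\<close> all supports except that of the simple root. On the right-hand side
  supports are carried back, so \<open>P\<close> judges subsets of \<open>R\<close> on both
  sides.\<close>

lemma card_Rq_step:
  assumes i: "i \<in> nodes \<Gamma>" and R: "R \<in> Om" and n: "simple_root i \<notin> R"
    and P: "\<not> P (supp R (simple_root i))"
  shows "card {\<gamma> \<in> Rs R. P (supp R \<gamma>)} =
     card {\<gamma> \<in> Rs (act (sr i) R). P (act (sr i) (supp (act (sr i) R) \<gamma>))}" (is "card ?A = card ?B")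
proof -
  define R' where "R' = act (sr i) R"
  have R': "R' \<in> Om" "simple_root i \<notin> R'" "act (sr i) R' = R"
    using act_Om[OF simple_Iso[OF i] R] simple_not_in_act[OF i R n] R
    by (auto simp: R'_def Om_iff intro!: act_reflection_involution simple_in_Phi i)
  have s: "act (sr i) (supp R' (sr i \<gamma>)) = supp R \<gamma>" for \<gamma>
  proof -
    have "act (sr i) (supp R \<gamma>) = supp R' (sr i \<gamma>)"
      unfolding R'_def by (rule supp_act[OF simple_Iso[OF i], symmetric])
    moreover have "supp R \<gamma> \<subseteq> Pos"
      using supp_subset R by (auto simp: Om_iff)
    ultimately show ?thesis
      using act_reflection_involution[OF simple_in_Phi[OF i]] by metis
  qed
  have inv: "sr i (sr i \<gamma>) = \<gamma>" for \<gamma>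
    by (simp add: reflection_involution simple_in_Phi i)
  have "bij_betw (sr i) ?A ?B"
  proof (rule bij_betwI[where g = "sr i"])
    show "sr i \<in> ?A \<rightarrow> ?B"
    proof
      fix \<gamma> assume g: "\<gamma> \<in> ?A"
      then have "supp R \<gamma> \<noteq> supp R (simple_root i)"
        using P by auto
      then show "sr i \<gamma> \<in> ?B"
        using Rq_step[OF i R n] g s by (auto simp: R'_def[symmetric])
    qed
    show "sr i \<in> ?B \<rightarrow> ?A"
    proof
      fix \<gamma> assume g: "\<gamma> \<in> ?B"
      have e: "supp R (sr i \<gamma>) = act (sr i) (supp R' \<gamma>)"
        using supp_act[OF simple_Iso[OF i], of R' \<gamma>] R'(3) by simp
      have "act (sr i) (supp R' (simple_root i)) = supp R (simple_root i)"
        using s[of "simple_root i"] by (simp add: simple_self i supp_uminus)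
      then have "supp R' \<gamma> \<noteq> supp R' (simple_root i)"
        using g P by (auto simp: R'_def[symmetric])
      then have "sr i \<gamma> \<in> Rs R"
        using Rq_step[OF i R'(1,2), of \<gamma>] g R'(3) by (simp add: R'_def[symmetric])
      then show "sr i \<gamma> \<in> ?A"
        using e g by (simp add: R'_def[symmetric])
    qed
  qed (use inv in auto)
  then show ?thesis
    by (rule bij_betw_same_card)
qed

lemma lev_invariant:
  assumes i: "i \<in> nodes \<Gamma>" and R: "R \<in> Om" and s: "supp R \<alpha> \<noteq> supp R (simple_root i)"
  shows "lev (act (sr i) R) (sr i \<alpha>) = lev R \<alpha>"
proof (cases "simple_root i \<in> R")
  case True
  then show ?thesis
    by (simp add: act_fixed[OF R] lev_def supp_reflection[OF R])
next
  case False
  have "act (sr i) X = supp R \<alpha> \<longleftrightarrow> X = supp (act (sr i) R) (sr i \<alpha>)" if "X \<subseteq> act (sr i) R" for X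
  proof -
    have "X \<subseteq> Pos" "supp R \<alpha> \<subseteq> Pos"
      using that Om_Pos[OF act_Om[OF simple_Iso[OF i] R]] supp_Pos[OF R] by blast+
    then show ?thesis
      using act_reflection_involution[OF simple_in_Phi[OF i]] supp_act[OF simple_Iso[OF i], of R \<alpha>] by metis
  qed
  then show ?thesis
    using card_Rq_step[OF i R False, of "\<lambda>X. X = supp R \<alpha>"] s supp_subset
    by (simp add: lev_def Rq_def)
qed

lemma rh_step:
  assumes i: "i \<in> nodes \<Gamma>" and R: "R \<in> Om" and n: "simple_root i \<notin> R"
  shows "rh (act (sr i) R) - rh R = int (lev (act (sr i) R) (simple_root i)) - int (lev R (simple_root i))"
proof -
  define R' where "R' = act (sr i) R"
  have split: "rh R = int (lev R \<alpha>) + int (card {\<gamma> \<in> Rs R. supp R \<gamma> \<noteq> supp R \<alpha>})" for R \<alpha>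
  proof -
    have "Rs R = Rq R (supp R \<alpha>) \<union> {\<gamma> \<in> Rs R. supp R \<gamma> \<noteq> supp R \<alpha>}"
      by (auto simp: Rq_def)
    then have "card (Rs R) = card (Rq R (supp R \<alpha>)) + card {\<gamma> \<in> Rs R. supp R \<gamma> \<noteq> supp R \<alpha>}"
      using finite_Rs by (metis (no_types, lifting) Rq_def card_Un_disjoint disjoint_iff finite_Un mem_Collect_eq)
    then show ?thesis
      by (simp add: rho_def lev_def)
  qed
  have s: "supp R' (simple_root i) = act (sr i) (supp R (simple_root i))"
    using supp_act[OF simple_Iso[OF i], of R "simple_root i"]
    by (simp add: R'_def simple_self i supp_uminus)
  have "act (sr i) X = supp R (simple_root i) \<longleftrightarrow> X = supp R' (simple_root i)" if "X \<subseteq> R'" for X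
  proof -
    have "X \<subseteq> Pos" "supp R (simple_root i) \<subseteq> Pos"
      using that Om_Pos[OF act_Om[OF simple_Iso[OF i] R]] supp_Pos[OF R] by (auto simp: R'_def)
    then show ?thesis
      using act_reflection_involution[OF simple_in_Phi[OF i]] s by metis
  qed
  then have "card {\<gamma> \<in> Rs R. supp R \<gamma> \<noteq> supp R (simple_root i)}
      = card {\<gamma> \<in> Rs R'. supp R' \<gamma> \<noteq> supp R' (simple_root i)}"
    using card_Rq_step[OF i R n, of "\<lambda>X. X \<noteq> supp R (simple_root i)"] supp_subset[of R']
    by (simp add: R'_def)
  then show ?thesis
    using split[of R "simple_root i"] split[of R' "simple_root i"] by (simp add: R'_def)
qed

section \<open>Quadruples\<close>

text \<open>The signs are absorbed into the four vectors: they lie in \<plusminus>R, and \<zeta> is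
  their half-sum with plus signs only.\<close>

definition quad_frame :: "vec set \<Rightarrow> vec \<Rightarrow> vec \<Rightarrow> vec \<Rightarrow> vec \<Rightarrow> vec \<Rightarrow> bool" where
  "quad_frame R \<zeta> c1 c2 c3 c4 \<longleftrightarrow> \<zeta> \<in> Phi \<and> c1 \<in> Phi \<and> c2 \<in> Phi \<and> c3 \<in> Phi \<and> c4 \<in> Phi \<and>
     abs_root \<Gamma> c1 \<in> R \<and> abs_root \<Gamma> c2 \<in> R \<and> abs_root \<Gamma> c3 \<in> R \<and> abs_root \<Gamma> c4 \<in> R \<and>
     B c1 c2 = 0 \<and> B c1 c3 = 0 \<and> B c1 c4 = 0 \<and> B c2 c3 = 0 \<and> B c2 c4 = 0 \<and> B c3 c4 = 0 \<and>
     (\<forall>j. c1 j + c2 j + c3 j + c4 j = 2 * \<zeta> j)"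

text \<open>The product of \<zeta> with an element of its support is the required sign, and
  \<open>Om_expand\<close> gives the half-sum. Sorting by height meets the ordering that the lemmas
  on \<open>level4\<close> assume.\<close>

lemma quad_frame_exists:
  assumes R: "R \<in> Om" and z: "\<zeta> \<in> Phi" and n: "\<zeta> \<notin> R" "(\<lambda>j. - \<zeta> j) \<notin> R"
  obtains c1 c2 c3 c4 where "quad_frame R \<zeta> c1 c2 c3 c4"
    "h c1 \<le> h c2" "h c2 \<le> h c3" "h c3 \<le> h c4"
proof -
  define c where "c = (\<lambda>\<beta> j. B \<zeta> \<beta> * \<beta> j)"
  define C where "C = c ` supp R \<zeta>"
  have s: "card (supp R \<zeta>) = 4" and b: "\<And>\<beta>. \<beta> \<in> supp R \<zeta> \<Longrightarrow> B \<zeta> \<beta> = 1 \<or> B \<zeta> \<beta> = -1"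
    using supp_cases[OF R z] n by auto
  have c: "c \<beta> = \<beta> \<or> c \<beta> = (\<lambda>j. - \<beta> j)" if "\<beta> \<in> supp R \<zeta>" for \<beta>
    using b[OF that] by (auto simp: c_def)
  have orth: "B (c \<beta>) (c \<gamma>) = 0" if "\<beta> \<in> supp R \<zeta>" "\<gamma> \<in> supp R \<zeta>" "\<beta> \<noteq> \<gamma>" for \<beta> \<gamma>
    using Om_orthogonal[OF R _ _ that(3)] that supp_subset by (auto simp: c_def form_linear)
  have cP: "c \<beta> \<in> Phi" "abs_root \<Gamma> (c \<beta>) \<in> R" if "\<beta> \<in> supp R \<zeta>" for \<beta>
  proof -
    have "\<beta> \<in> R"
      using that supp_subset by blast
    then show "c \<beta> \<in> Phi" "abs_root \<Gamma> (c \<beta>) \<in> R"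
      using c[OF that] Om_Phi[OF R] Phi_uminus abs_root_uminus abs_root_id[OF Om_Pos[OF R]] by metis+
  qed
  have inj: "inj_on c (supp R \<zeta>)"
  proof (rule inj_onI, rule ccontr)
    fix \<beta> \<gamma>
    assume "\<beta> \<in> supp R \<zeta>" "\<gamma> \<in> supp R \<zeta>" "c \<beta> = c \<gamma>" "\<beta> \<noteq> \<gamma>"
    then show False
      using orth cP(1) Phi_norm by (metis zero_neq_numeral)
  qed
  have "finite (supp R \<zeta>)"
    using s card.infinite by fastforce
  then obtain ys where ys: "set ys = C" "distinct ys"
    using finite_distinct_list[of C] by (auto simp: C_def)
  define xs where "xs = sort_key h ys"
  have xs: "set xs = C" "distinct xs" "sorted (map h xs)"
    using ys by (simp_all add: xs_def)
  have "length xs = 4"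
    using distinct_card[OF xs(2)] xs(1) card_image[OF inj] s by (simp add: C_def)
  then obtain c1 c2 c3 c4 where x: "xs = [c1, c2, c3, c4]"
    by (auto simp: numeral_eq_Suc length_Suc_conv)
  then have C: "C = {c1, c2, c3, c4}" "distinct [c1, c2, c3, c4]"
    using xs by auto
  have o: "B u v = 0" if "u \<in> C" "v \<in> C" "u \<noteq> v" for u v
    using that orth by (auto simp: C_def)
  have P: "u \<in> Phi" "abs_root \<Gamma> u \<in> R" if "u \<in> C" for u
    using that cP by (auto simp: C_def)
  have "2 * \<zeta> j = (\<Sum>\<beta>\<in>supp R \<zeta>. c \<beta> j)" for j
    unfolding Om_expand[OF R Phi_supported[OF z], of j]
    by (intro sum.mono_neutral_cong_right) (auto simp: supp_def c_def Om_finite[OF R])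
  also have "(\<Sum>\<beta>\<in>supp R \<zeta>. c \<beta> j) = (\<Sum>u\<in>C. u j)" for j
    using sum.reindex[OF inj, of "\<lambda>u. u j"] by (simp add: C_def)
  finally have "2 * \<zeta> j = c1 j + c2 j + c3 j + c4 j" for j
    using C by simp
  then have "quad_frame R \<zeta> c1 c2 c3 c4"
    unfolding quad_frame_def using z P o C by (auto simp: insert_commute)
  then show ?thesis
    using that xs(3) x by simp
qed

lemma abs_root_orth_neq:
  assumes "u \<in> Phi" "B u v = 0"
  shows "abs_root \<Gamma> u \<noteq> abs_root \<Gamma> v"
proof
  assume "abs_root \<Gamma> u = abs_root \<Gamma> v"
  moreover have "B u (abs_root \<Gamma> v) = 0"
    using assms(2) by (simp add: form_abs_root_zero_iff)
  ultimately have "B u u = 0"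
    using form_abs_root_zero_iff(2)[of u u] by simp
  then show False
    using Phi_norm[OF assms(1)] by simp
qed

lemma quad_frame_supp:
  assumes R: "R \<in> Om" and f: "quad_frame R \<zeta> c1 c2 c3 c4"
    and g: "\<And>j. 2 * \<gamma> j = p * c1 j + q * c2 j + r * c3 j + s * c4 j"
  shows "2 * B \<gamma> v = p * B c1 v + q * B c2 v + r * B c3 v + s * B c4 v"
    and "B \<gamma> c1 = p" "B \<gamma> c2 = q" "B \<gamma> c3 = r" "B \<gamma> c4 = s"
    and "2 * h \<gamma> = p * h c1 + q * h c2 + r * h c3 + s * h c4"
    and "p \<noteq> 0 \<Longrightarrow> q \<noteq> 0 \<Longrightarrow> r \<noteq> 0 \<Longrightarrow> s \<noteq> 0 \<Longrightarrow>
      supp R \<gamma> = {abs_root \<Gamma> c1, abs_root \<Gamma> c2, abs_root \<Gamma> c3, abs_root \<Gamma> c4}"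
proof -
  have n: "B c1 c1 = 2" "B c2 c2 = 2" "B c3 c3 = 2" "B c4 c4 = 2"
    using f by (auto simp: quad_frame_def Phi_norm)
  have o: "B c1 c2 = 0" "B c1 c3 = 0" "B c1 c4 = 0" "B c2 c3 = 0" "B c2 c4 = 0" "B c3 c4 = 0"
    "B c2 c1 = 0" "B c3 c1 = 0" "B c4 c1 = 0" "B c3 c2 = 0" "B c4 c2 = 0" "B c4 c3 = 0"
    using f by (auto simp: quad_frame_def form_commute[of \<Gamma> c2 c1] form_commute[of \<Gamma> c3 c1]
        form_commute[of \<Gamma> c4 c1] form_commute[of \<Gamma> c3 c2] form_commute[of \<Gamma> c4 c2] form_commute[of \<Gamma> c4 c3])
  show l: "2 * B \<gamma> v = p * B c1 v + q * B c2 v + r * B c3 v + s * B c4 v" for v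
  proof -
    have "2 * B \<gamma> v = B (\<lambda>j. 2 * \<gamma> j) v"
      by (simp only: form_smult_left)
    then show ?thesis
      unfolding g by (simp only: form_add_left form_smult_left)
  qed
  show v: "B \<gamma> c1 = p" "B \<gamma> c2 = q" "B \<gamma> c3 = r" "B \<gamma> c4 = s"
    using l[of c1] l[of c2] l[of c3] l[of c4] by (simp_all add: n o)
  have "2 * h \<gamma> = h (\<lambda>j. 2 * \<gamma> j)"
    by (simp only: height_smult)
  then show "2 * h \<gamma> = p * h c1 + q * h c2 + r * h c3 + s * h c4"
    unfolding g by (simp only: height_add height_smult)
  assume nz: "p \<noteq> 0" "q \<noteq> 0" "r \<noteq> 0" "s \<noteq> 0"
  have R4: "abs_root \<Gamma> c1 \<in> R" "abs_root \<Gamma> c2 \<in> R" "abs_root \<Gamma> c3 \<in> R" "abs_root \<Gamma> c4 \<in> R"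
    using f by (auto simp: quad_frame_def)
  have "B \<gamma> \<beta> = 0" if "\<beta> \<in> R" "\<beta> \<notin> {abs_root \<Gamma> c1, abs_root \<Gamma> c2, abs_root \<Gamma> c3, abs_root \<Gamma> c4}" for \<beta>
  proof -
    have "B (abs_root \<Gamma> c1) \<beta> = 0" "B (abs_root \<Gamma> c2) \<beta> = 0" "B (abs_root \<Gamma> c3) \<beta> = 0" "B (abs_root \<Gamma> c4) \<beta> = 0"
      using Om_orthogonal[OF R] R4 that by auto
    then show ?thesis
      using l[of \<beta>] by (simp add: form_abs_root_zero_iff)
  qed
  moreover have "B \<gamma> \<beta> \<noteq> 0" if "\<beta> \<in> {abs_root \<Gamma> c1, abs_root \<Gamma> c2, abs_root \<Gamma> c3, abs_root \<Gamma> c4}" for \<beta>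
    using that v nz by (auto simp: form_abs_root_zero_iff)
  ultimately show "supp R \<gamma> = {abs_root \<Gamma> c1, abs_root \<Gamma> c2, abs_root \<Gamma> c3, abs_root \<Gamma> c4}"
    using R4 by (auto simp: supp_def)
qed

lemma quad_frame_zeta:
  assumes R: "R \<in> Om" and f: "quad_frame R \<zeta> c1 c2 c3 c4"
  shows "B \<zeta> c1 = 1" "B \<zeta> c2 = 1" "B \<zeta> c3 = 1" "B \<zeta> c4 = 1"
    and "2 * h \<zeta> = h c1 + h c2 + h c3 + h c4"
    and "supp R \<zeta> = {abs_root \<Gamma> c1, abs_root \<Gamma> c2, abs_root \<Gamma> c3, abs_root \<Gamma> c4}"
proof -
  have "2 * \<zeta> j = 1 * c1 j + 1 * c2 j + 1 * c3 j + 1 * c4 j" for j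
    using f by (simp add: quad_frame_def)
  note quad_frame_supp[OF R f this]
  then show "B \<zeta> c1 = 1" "B \<zeta> c2 = 1" "B \<zeta> c3 = 1" "B \<zeta> c4 = 1"
    and "2 * h \<zeta> = h c1 + h c2 + h c3 + h c4"
    and "supp R \<zeta> = {abs_root \<Gamma> c1, abs_root \<Gamma> c2, abs_root \<Gamma> c3, abs_root \<Gamma> c4}"
    by simp_all
qed

lemma squares_sum_4:
  fixes x y z w :: int
  assumes "x * x + y * y + z * z + w * w = 4" "x \<noteq> 0" "y \<noteq> 0" "z \<noteq> 0" "w \<noteq> 0"
  shows "x = 1 \<or> x = -1" "y = 1 \<or> y = -1" "z = 1 \<or> z = -1" "w = 1 \<or> w = -1"
proof -
  have ge: "a * a \<ge> 1" if "a \<noteq> 0" for a :: int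
    using that by (metis int_one_le_iff_zero_less not_square_less_zero mult_eq_0_iff order_le_less not_less)
  have "x * x = 1" "y * y = 1" "z * z = 1" "w * w = 1"
    using ge[OF assms(2)] ge[OF assms(3)] ge[OF assms(4)] ge[OF assms(5)] assms(1) by linarith+
  then show "x = 1 \<or> x = -1" "y = 1 \<or> y = -1" "z = 1 \<or> z = -1" "w = 1 \<or> w = -1"
    by (simp_all add: square_eq_1_iff)
qed

text \<open>Four nonzero integers whose squares sum to 4 are all \<plusminus>1.\<close>

lemma quad_frame_expand:
  assumes R: "R \<in> Om" and f: "quad_frame R \<zeta> c1 c2 c3 c4"
    and g: "\<gamma> \<in> Phi" "supp R \<gamma> = supp R \<zeta>"
  shows "2 * \<gamma> j = B \<gamma> c1 * c1 j + B \<gamma> c2 * c2 j + B \<gamma> c3 * c3 j + B \<gamma> c4 * c4 j"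
    and "(B \<gamma> c1, B \<gamma> c2, B \<gamma> c3, B \<gamma> c4) \<in> signs4"
proof -
  note s = quad_frame_zeta(6)[OF R f]
  have cP: "c1 \<in> Phi" "c2 \<in> Phi" "c3 \<in> Phi" "c4 \<in> Phi"
    and o: "B c1 c2 = 0" "B c1 c3 = 0" "B c1 c4 = 0" "B c2 c3 = 0" "B c2 c4 = 0" "B c3 c4 = 0"
    using f by (auto simp: quad_frame_def)
  have ne: "abs_root \<Gamma> c1 \<noteq> abs_root \<Gamma> c2" "abs_root \<Gamma> c1 \<noteq> abs_root \<Gamma> c3" "abs_root \<Gamma> c1 \<noteq> abs_root \<Gamma> c4"
    "abs_root \<Gamma> c2 \<noteq> abs_root \<Gamma> c3" "abs_root \<Gamma> c2 \<noteq> abs_root \<Gamma> c4" "abs_root \<Gamma> c3 \<noteq> abs_root \<Gamma> c4"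
    using abs_root_orth_neq cP o by blast+
  have a: "B \<gamma> (abs_root \<Gamma> c) * abs_root \<Gamma> c j = B \<gamma> c * c j" for c j
    using abs_root_cases[of c] by (auto simp: form_linear)
  show e: "2 * \<gamma> j = B \<gamma> c1 * c1 j + B \<gamma> c2 * c2 j + B \<gamma> c3 * c3 j + B \<gamma> c4 * c4 j" for j
  proof -
    have "2 * \<gamma> j = (\<Sum>\<beta>\<in>supp R \<gamma>. B \<gamma> \<beta> * \<beta> j)"
      unfolding Om_expand[OF R Phi_supported[OF g(1)], of j]
      by (intro sum.mono_neutral_right) (auto simp: supp_def Om_finite[OF R])
    then show ?thesis
      using ne by (simp add: g(2) s a)
  qed
  have nz: "B \<gamma> c1 \<noteq> 0" "B \<gamma> c2 \<noteq> 0" "B \<gamma> c3 \<noteq> 0" "B \<gamma> c4 \<noteq> 0"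
  proof -
    have "B \<gamma> (abs_root \<Gamma> c) \<noteq> 0" if "abs_root \<Gamma> c \<in> supp R \<zeta>" for c
      using that unfolding g(2)[symmetric] by (simp add: supp_def)
    then show "B \<gamma> c1 \<noteq> 0" "B \<gamma> c2 \<noteq> 0" "B \<gamma> c3 \<noteq> 0" "B \<gamma> c4 \<noteq> 0"
      using s by (simp_all add: form_abs_root_zero_iff)
  qed
  have "2 * B \<gamma> \<gamma> = B \<gamma> c1 * B c1 \<gamma> + B \<gamma> c2 * B c2 \<gamma> + B \<gamma> c3 * B c3 \<gamma> + B \<gamma> c4 * B c4 \<gamma>"
    by (rule quad_frame_supp(1)[OF R f e])
  then have "B \<gamma> c1 * B \<gamma> c1 + B \<gamma> c2 * B \<gamma> c2 + B \<gamma> c3 * B \<gamma> c3 + B \<gamma> c4 * B \<gamma> c4 = 4"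
    using Phi_norm[OF g(1)] by (simp add: form_commute[of \<Gamma> c1 \<gamma>] form_commute[of \<Gamma> c2 \<gamma>]
        form_commute[of \<Gamma> c3 \<gamma>] form_commute[of \<Gamma> c4 \<gamma>])
  from squares_sum_4[OF this nz]
  show "(B \<gamma> c1, B \<gamma> c2, B \<gamma> c3, B \<gamma> c4) \<in> signs4"
    unfolding signs4_def mem_Times_iff fst_conv snd_conv insert_iff empty_iff by blast
qed

text \<open>Elements of \<open>R\<close> outside the quadruple are orthogonal to \<gamma> and their
  reflections fix it, so only the four sign changes are tested, and positivity is read off from
  heights.\<close>

lemma quad_frame_half_sum:
  assumes R: "R \<in> Om" and f: "quad_frame R \<zeta> c1 c2 c3 c4" and x: "(p, q, r, s) \<in> signs4"
    and g: "\<And>j. 2 * \<gamma> j = p * c1 j + q * c2 j + r * c3 j + s * c4 j"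
  shows "\<gamma> \<in> Phi" "supp R \<gamma> = supp R \<zeta>"
    and "\<gamma> \<in> Rs R \<longleftrightarrow> stable4 (h c1) (h c2) (h c3) (h c4) (p, q, r, s)"
proof -
  note F = quad_frame_supp[OF R f g]
  have sq: "p * p = 1" "q * q = 1" "r * r = 1" "s * s = 1" and nz: "p \<noteq> 0" "q \<noteq> 0" "r \<noteq> 0" "s \<noteq> 0"
    using x by (auto simp: signs4_def)
  have c: "B c1 \<gamma> = p" "B c2 \<gamma> = q" "B c3 \<gamma> = r" "B c4 \<gamma> = s"
    using F(2-5) form_commute by metis+
  have cP: "c1 \<in> Phi" "c2 \<in> Phi" "c3 \<in> Phi" "c4 \<in> Phi"
    using f by (auto simp: quad_frame_def)
  have "B \<gamma> \<gamma> = 2"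
    using F(1)[of \<gamma>] by (simp add: c sq)
  moreover have "\<gamma> i = 0" if "i \<notin> nodes \<Gamma>" for i
    using g[of i] cP[THEN Phi_supported] that by (simp add: supported_def)
  ultimately show P: "\<gamma> \<in> Phi"
    by (simp add: Phi_def supported_def)
  show s: "supp R \<gamma> = supp R \<zeta>"
    using F(7)[OF nz] quad_frame_zeta(6)[OF R f] by simp
  have rp: "refl (abs_root \<Gamma> c) \<gamma> \<in> Pos \<longleftrightarrow> B c \<gamma> * h c < h \<gamma>" if "c \<in> Phi" for c
    using Pos_iff_height[OF Phi_reflection[OF that P]]
    by (simp add: reflection_abs_root reflection_def height_linear)
  have "\<gamma> \<in> Rs R \<longleftrightarrow> \<gamma> \<in> Pos \<and> (\<forall>\<beta>\<in>supp R \<gamma>. refl \<beta> \<gamma> \<in> Pos)"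
  proof -
    have "refl \<beta> \<gamma> = \<gamma>" if "\<beta> \<in> R" "\<beta> \<notin> supp R \<gamma>" for \<beta>
      using that form_commute[of \<Gamma> \<beta> \<gamma>] by (simp add: supp_def reflection_def)
    then show ?thesis
      using supp_subset[of R \<gamma>] unfolding Rs_iff by (metis subsetD)
  qed
  also have "\<dots> \<longleftrightarrow> 0 < h \<gamma> \<and> p * h c1 < h \<gamma> \<and> q * h c2 < h \<gamma> \<and> r * h c3 < h \<gamma> \<and> s * h c4 < h \<gamma>"
    unfolding s quad_frame_zeta(6)[OF R f] using cP by (simp add: rp c Pos_iff_height[OF P])
  also have "\<dots> \<longleftrightarrow> stable4 (h c1) (h c2) (h c3) (h c4) (p, q, r, s)"
    using F(6) by (auto simp: stable4_def Let_def)
  finally show "\<gamma> \<in> Rs R \<longleftrightarrow> stable4 (h c1) (h c2) (h c3) (h c4) (p, q, r, s)" .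
qed

text \<open>A root with the support of \<zeta> is determined by its sign vector \<open>T\<close>,
  and every sign vector occurs.\<close>

lemma quad_frame_level:
  assumes R: "R \<in> Om" and f: "quad_frame R \<zeta> c1 c2 c3 c4"
  shows "lev R \<zeta> = level4 (h c1) (h c2) (h c3) (h c4)"
proof -
  define T where "T = (\<lambda>\<gamma>. (B \<gamma> c1, B \<gamma> c2, B \<gamma> c3, B \<gamma> c4))"
  let ?S = "{x \<in> signs4. stable4 (h c1) (h c2) (h c3) (h c4) x}"
  have "bij_betw T (Rq R (supp R \<zeta>)) ?S"
  proof (rule bij_betw_imageI)
    have P: "\<gamma> \<in> Phi \<and> supp R \<gamma> = supp R \<zeta> \<and> \<gamma> \<in> Rs R" if "\<gamma> \<in> Rq R (supp R \<zeta>)" for \<gamma>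
      using that Pos_in_Phi by (auto simp: Rq_def Rs_iff)
    show "inj_on T (Rq R (supp R \<zeta>))"
    proof (rule inj_onI)
      fix \<gamma> \<delta>
      assume gd: "\<gamma> \<in> Rq R (supp R \<zeta>)" "\<delta> \<in> Rq R (supp R \<zeta>)" "T \<gamma> = T \<delta>"
      have "2 * \<gamma> j = 2 * \<delta> j" for j
        using quad_frame_expand(1)[OF R f, of \<gamma> j] quad_frame_expand(1)[OF R f, of \<delta> j] gd P
        by (simp add: T_def)
      then show "\<gamma> = \<delta>"
        by (simp add: fun_eq_iff)
    qed
    show "T ` Rq R (supp R \<zeta>) = ?S"
    proof (intro equalityI subsetI)
      fix x
      assume "x \<in> T ` Rq R (supp R \<zeta>)"
      then obtain \<gamma> where g: "\<gamma> \<in> Rq R (supp R \<zeta>)" "x = T \<gamma>"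
        by blast
      then show "x \<in> ?S"
        using quad_frame_expand[OF R f, of \<gamma>] quad_frame_half_sum(3)[OF R f, of _ _ _ _ \<gamma>] P[OF g(1)]
        unfolding T_def by blast
    next
      fix x
      assume x: "x \<in> ?S"
      obtain p q r s where pq: "x = (p, q, r, s)"
        by (cases x)
      \<comment> \<open>The value is 0 for the sign 1 and 1 for the sign -1. Subtracting the vectors
        with negative sign from \<zeta> yields the half-sum as an integral vector.\<close>
      define n where "n = (\<lambda>p :: int. (1 - p) div 2)"
      have n: "2 * n t = 1 - t" if "t \<in> {1, - 1}" for t
        using that by (auto simp: n_def)
      have np: "2 * n p = 1 - p" "2 * n q = 1 - q" "2 * n r = 1 - r" "2 * n s = 1 - s"
        using x by (auto simp: pq signs4_def intro!: n)
      define \<gamma> where "\<gamma> = (\<lambda>j. \<zeta> j - n p * c1 j - n q * c2 j - n r * c3 j - n s * c4 j)"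
      have g: "2 * \<gamma> j = p * c1 j + q * c2 j + r * c3 j + s * c4 j" for j
      proof -
        have "2 * \<gamma> j = 2 * \<zeta> j - (2 * n p) * c1 j - (2 * n q) * c2 j - (2 * n r) * c3 j - (2 * n s) * c4 j"
          by (simp add: \<gamma>_def algebra_simps)
        also have "2 * \<zeta> j = c1 j + c2 j + c3 j + c4 j"
          using f by (simp add: quad_frame_def)
        finally show ?thesis
          unfolding np by (simp add: algebra_simps)
      qed
      have xs: "(p, q, r, s) \<in> signs4"
        using x pq by simp
      have "\<gamma> \<in> Rq R (supp R \<zeta>)"
        using quad_frame_half_sum(2,3)[OF R f xs g] x pq by (simp add: Rq_def)
      moreover have "T \<gamma> = x"
        using quad_frame_supp(2-5)[OF R f g] pq by (simp add: T_def)
      ultimately show "x \<in> T ` Rq R (supp R \<zeta>)"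
        by blast
    qed
  qed
  then show ?thesis
    using bij_betw_same_card by (auto simp: lev_def level4_def)
qed

text \<open>The reflection takes each vector \<open>c\<close> of the frame to
  \<open>c - \<zeta>\<close>. The four images sum to -2 times \<zeta>, so the new frame belongs to
  the negative of \<zeta>.\<close>

lemma quad_frame_reflect:
  assumes R: "R \<in> Om" and f: "quad_frame R \<zeta> c1 c2 c3 c4"
  shows "quad_frame (act (refl \<zeta>) R) (\<lambda>j. - \<zeta> j) (\<lambda>j. c1 j - \<zeta> j) (\<lambda>j. c2 j - \<zeta> j) (\<lambda>j. c3 j - \<zeta> j) (\<lambda>j. c4 j - \<zeta> j)"
proof -
  have z: "\<zeta> \<in> Phi"
    using f by (simp add: quad_frame_def)
  have e: "(\<lambda>j. c j - \<zeta> j) = refl \<zeta> c" if "B \<zeta> c = 1" for c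
    using that by (simp add: reflection_def)
  have a: "abs_root \<Gamma> (refl \<zeta> c) \<in> act (refl \<zeta>) R" if "c \<in> Phi" "abs_root \<Gamma> c \<in> R" for c
    using abs_root_Iso[OF reflection_in_Iso[OF z] that(1)] that(2) unfolding standard_action_def
    by (intro image_eqI[of _ _ "abs_root \<Gamma> c"]) simp_all
  have s: "c1 j - \<zeta> j + (c2 j - \<zeta> j) + (c3 j - \<zeta> j) + (c4 j - \<zeta> j) = 2 * - \<zeta> j" for j
  proof -
    have "c1 j + c2 j + c3 j + c4 j = 2 * \<zeta> j"
      using f by (simp add: quad_frame_def)
    then show ?thesis
      by linarith
  qed
  have F: "c1 \<in> Phi" "c2 \<in> Phi" "c3 \<in> Phi" "c4 \<in> Phi"
    "abs_root \<Gamma> c1 \<in> R" "abs_root \<Gamma> c2 \<in> R" "abs_root \<Gamma> c3 \<in> R" "abs_root \<Gamma> c4 \<in> R"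
    "B c1 c2 = 0" "B c1 c3 = 0" "B c1 c4 = 0" "B c2 c3 = 0" "B c2 c4 = 0" "B c3 c4 = 0"
    using f by (simp_all add: quad_frame_def)
  have s': "\<forall>j. refl \<zeta> c1 j + refl \<zeta> c2 j + refl \<zeta> c3 j + refl \<zeta> c4 j = 2 * - \<zeta> j"
    using s by (simp add: reflection_def quad_frame_zeta(1-4)[OF R f])
  show ?thesis
    unfolding quad_frame_zeta(1-4)[OF R f, THEN e] quad_frame_def
    by (intro conjI s' Phi_uminus[OF z] Phi_reflection z a F; simp only: Iso_form[OF reflection_in_Iso[OF z]] F)
qed

lemma quad_frame_level_reflect:
  assumes R: "R \<in> Om" and f: "quad_frame R \<zeta> c1 c2 c3 c4"
  shows "lev (act (refl \<zeta>) R) \<zeta> = level4 (h c1 - h \<zeta>) (h c2 - h \<zeta>) (h c3 - h \<zeta>) (h c4 - h \<zeta>)"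
proof -
  have z: "\<zeta> \<in> Phi"
    using f by (simp add: quad_frame_def)
  show ?thesis
    using quad_frame_level[OF act_Om[OF reflection_in_Iso[OF z] R] quad_frame_reflect[OF R f]]
    by (simp add: lev_def supp_uminus height_linear)
qed

lemma quad_frame_generic:
  assumes R: "R \<in> Om" and f: "quad_frame R \<zeta> c1 c2 c3 c4"
  shows "generic4 (h c1) (h c2) (h c3) (h c4) (h \<zeta>)"
proof -
  have P: "\<zeta> \<in> Phi" "c1 \<in> Phi" "c2 \<in> Phi" "c3 \<in> Phi" "c4 \<in> Phi"
    and o: "B c4 c3 = 0" "B c4 c2 = 0" "B c3 c2 = 0"
    using f by (auto simp: quad_frame_def form_commute[of \<Gamma> c4 c3] form_commute[of \<Gamma> c4 c2] form_commute[of \<Gamma> c3 c2])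
  note z = quad_frame_zeta[OF R f]
  have z': "B c2 \<zeta> = 1" "B c3 \<zeta> = 1" "B c4 \<zeta> = 1"
    using z(2-4) form_commute by metis+
  \<comment> \<open>These are the roots \<open>c - \<zeta>\<close> up to sign and the half-sums with
    two minus signs; the one with minus signs at \<open>c3\<close> and \<open>c4\<close> is the
    negative of the one with minus signs at \<open>c1\<close> and \<open>c2\<close>.\<close>
  have "h (refl \<zeta> c1) \<noteq> 0" "h (refl \<zeta> c2) \<noteq> 0" "h (refl \<zeta> c3) \<noteq> 0" "h (refl \<zeta> c4) \<noteq> 0"
    "h (refl c4 (refl c3 \<zeta>)) \<noteq> 0" "h (refl c4 (refl c2 \<zeta>)) \<noteq> 0" "h (refl c3 (refl c2 \<zeta>)) \<noteq> 0"
    "h \<zeta> \<noteq> 0" "h c1 \<noteq> 0" "h c2 \<noteq> 0" "h c3 \<noteq> 0" "h c4 \<noteq> 0"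
    using P by (simp_all add: height_nonzero Phi_reflection)
  then have nz: "h c1 \<noteq> h \<zeta>" "h c2 \<noteq> h \<zeta>" "h c3 \<noteq> h \<zeta>" "h c4 \<noteq> h \<zeta>"
    "h \<zeta> - h c3 - h c4 \<noteq> 0" "h \<zeta> - h c2 - h c4 \<noteq> 0" "h \<zeta> - h c2 - h c3 \<noteq> 0"
    "h \<zeta> \<noteq> 0" "h c1 \<noteq> 0" "h c2 \<noteq> 0" "h c3 \<noteq> 0" "h c4 \<noteq> 0"
    by (simp_all add: reflection_def z z' o form_linear height_linear)
  have "h c1 + h c2 \<noteq> h \<zeta>" "h c1 + h c3 \<noteq> h \<zeta>" "h c1 + h c4 \<noteq> h \<zeta>"
    using z(5) nz(5-7) by linarith+
  then show ?thesis
    unfolding generic4_def using z(5) nz(1-4,8-12) by simp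
qed

text \<open>For the sign claim: if \<beta> were the negative of a frame vector, its height would be
  at most \<open>- h c1\<close>, hence less than \<open>h c4\<close>, but \<beta> is at least as
  high as the root of \<open>R\<close> belonging to \<open>c4\<close>.\<close>

lemma lev_simple:
  assumes i: "i \<in> nodes \<Gamma>" and R: "R \<in> Om" and n: "simple_root i \<notin> R"
  shows "\<bar>int (lev (act (sr i) R) (simple_root i)) - int (lev R (simple_root i))\<bar> = 1"
    and "lev R (simple_root i) < lev (act (sr i) R) (simple_root i) \<Longrightarrow> \<beta> \<in> supp R (simple_root i) \<Longrightarrow>
      (\<And>\<gamma>. \<gamma> \<in> supp R (simple_root i) \<Longrightarrow> h \<gamma> \<le> h \<beta>) \<Longrightarrow> B (simple_root i) \<beta> > 0"
proof -
  have "(\<lambda>j. - simple_root i j) \<notin> R"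
    using Om_Pos[OF R] uminus_Pos[OF simple_in_Pos[OF i]] by blast
  then obtain c1 c2 c3 c4 where f: "quad_frame R (simple_root i) c1 c2 c3 c4"
    and o: "h c1 \<le> h c2" "h c2 \<le> h c3" "h c3 \<le> h c4"
    using quad_frame_exists[OF R simple_in_Phi[OF i] n] by blast
  have g: "generic4 (h c1) (h c2) (h c3) (h c4) 1"
    using quad_frame_generic[OF R f] by (simp add: height_simple i)
  have l: "lev R (simple_root i) = level4 (h c1) (h c2) (h c3) (h c4)"
    "lev (act (sr i) R) (simple_root i) = level4 (h c1 - 1) (h c2 - 1) (h c3 - 1) (h c4 - 1)"
    using quad_frame_level[OF R f] quad_frame_level_reflect[OF R f] by (simp_all add: height_simple i)
  show "\<bar>int (lev (act (sr i) R) (simple_root i)) - int (lev R (simple_root i))\<bar> = 1"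
    unfolding l by (rule level4_simple(1)[OF g o])
  assume a: "lev R (simple_root i) < lev (act (sr i) R) (simple_root i)"
    and b: "\<beta> \<in> supp R (simple_root i)" and m: "\<And>\<gamma>. \<gamma> \<in> supp R (simple_root i) \<Longrightarrow> h \<gamma> \<le> h \<beta>"
  have pos: "h c1 + h c4 > 0"
    using level4_simple(2)[OF g o] a unfolding l .
  note z = quad_frame_zeta[OF R f]
  have cP: "c1 \<in> Phi" "c2 \<in> Phi" "c3 \<in> Phi" "c4 \<in> Phi"
    using f by (auto simp: quad_frame_def)
  have ab: "h c \<le> h (abs_root \<Gamma> c)" if "c \<in> Phi" for c
    using that Pos_iff_height[OF that] by (auto simp: abs_root_eq height_linear)
  have "h c4 \<le> h \<beta>"
    using m[of "abs_root \<Gamma> c4"] ab[OF cP(4)] z(6) by simp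
  moreover obtain c where c: "\<beta> = abs_root \<Gamma> c" "B (simple_root i) c = 1" "h c1 \<le> h c"
    using b o z(1-4) unfolding z(6) by fastforce
  ultimately have "\<beta> \<noteq> (\<lambda>j. - c j)"
    using pos by (auto simp: height_linear)
  then show "B (simple_root i) \<beta> > 0"
    using c abs_root_cases[of c] by simp
qed

text \<open>\<open>level4_neq\<close> needs a positive height; passing to the negative root changes
  neither the reflection nor the support.\<close>

lemma lev_neq:
  assumes R: "R \<in> Om" and a: "\<alpha> \<in> Phi" and n: "\<alpha> \<notin> R" "(\<lambda>j. - \<alpha> j) \<notin> R"
  shows "lev (act (refl \<alpha>) R) \<alpha> \<noteq> lev R \<alpha>"
proof -
  have *: "lev (act (refl \<alpha>) R) \<alpha> \<noteq> lev R \<alpha>"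
    if t: "\<alpha> \<in> Phi" "\<alpha> \<notin> R" "(\<lambda>j. - \<alpha> j) \<notin> R" "h \<alpha> > 0" for \<alpha>
  proof -
    obtain c1 c2 c3 c4 where f: "quad_frame R \<alpha> c1 c2 c3 c4"
      and o: "h c1 \<le> h c2" "h c2 \<le> h c3" "h c3 \<le> h c4"
      using quad_frame_exists[OF R t(1-3)] by blast
    show ?thesis
      unfolding quad_frame_level[OF R f] quad_frame_level_reflect[OF R f]
      by (rule level4_neq[OF quad_frame_generic[OF R f] o t(4)])
  qed
  show ?thesis
  proof (cases "h \<alpha> > 0")
    case True
    then show ?thesis
      using * assms by blast
  next
    case False
    then have "h (\<lambda>j. - \<alpha> j) > 0"
      using height_nonzero[OF a] by (simp add: height_linear)
    then show ?thesis
      using *[of "\<lambda>j. - \<alpha> j"] Phi_uminus[OF a] n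
      by (simp add: reflection_uminus_left lev_def supp_uminus)
  qed
qed

section \<open>Exchange and minimal elements\<close>

lemma supp_self:
  assumes R: "R \<in> Om" and a: "\<alpha> \<in> R \<or> (\<lambda>j. - \<alpha> j) \<in> R"
  shows "card (supp R \<alpha>) = 1"
proof -
  have *: "supp R \<alpha> = {\<alpha>}" if "\<alpha> \<in> R" for \<alpha>
    using that Om_orthogonal[OF R that] Phi_norm[OF Om_Phi[OF R that]] by (auto simp: supp_def)
  show ?thesis
    using a *[of \<alpha>] *[of "\<lambda>j. - \<alpha> j"] by (auto simp: supp_uminus)
qed

text \<open>The half-sums of a quadruple in \<open>R\<close> form, up to sign, two further orthogonal quadruples,
  distinguished by the parity of the number of minus signs.\<close>

lemma three_quadruples:
  assumes R: "R \<in> Om" and a: "\<alpha> \<in> Phi" and z: "\<zeta> \<in> Phi" and s: "supp R \<alpha> = supp R \<zeta>"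
  shows "act (refl \<alpha>) R = act (refl \<zeta>) R \<or> abs_root \<Gamma> \<zeta> \<in> act (refl \<alpha>) R"
proof (cases "\<alpha> \<in> R \<or> (\<lambda>j. - \<alpha> j) \<in> R \<or> \<zeta> \<in> R \<or> (\<lambda>j. - \<zeta> j) \<in> R")
  case True
  then have "card (supp R \<alpha>) = 1"
    using supp_self[OF R] s by metis
  then have "\<alpha> \<in> R \<or> (\<lambda>j. - \<alpha> j) \<in> R" "\<zeta> \<in> R \<or> (\<lambda>j. - \<zeta> j) \<in> R"
    using supp_cases[OF R a] supp_cases[OF R z] s by auto
  then show ?thesis
    using act_fixed[OF R] by metis
next
  case False
  have b: "B \<alpha> \<beta> = 0 \<and> B \<zeta> \<beta> = 0 \<or> (B \<alpha> \<beta> = 1 \<or> B \<alpha> \<beta> = -1) \<and> (B \<zeta> \<beta> = 1 \<or> B \<zeta> \<beta> = -1)"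
    if "\<beta> \<in> R" for \<beta>
  proof (cases "\<beta> \<in> supp R \<alpha>")
    case t: True
    then show ?thesis
      using supp_cases[OF R a] supp_cases[OF R z] False s by auto
  next
    case f: False
    then have "\<beta> \<notin> supp R \<zeta>"
      using s by simp
    with f show ?thesis
      using that by (simp add: supp_def)
  qed
  consider "B \<alpha> \<zeta> = 2 \<or> B \<alpha> \<zeta> = -2" | "B \<alpha> \<zeta> = 0" | "B \<alpha> \<zeta> = 1 \<or> B \<alpha> \<zeta> = -1"
    using form_bounds(1,2)[OF a z] by linarith
  then show ?thesis
  proof cases
    case 1
    then have "\<alpha> = \<zeta> \<or> \<alpha> = (\<lambda>j. - \<zeta> j)"
      using form_bounds(3,4)[OF a z] by blast
    then show ?thesis
      by (auto simp: reflection_uminus_left)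
  next
    case 2
    \<comment> \<open>Equal supports make the products of \<alpha> and \<zeta> with \<open>R\<close>
      agree modulo 2. For orthogonal \<alpha> and \<zeta> the two correction terms then cancel
      modulo 2, so the composite of the two reflections maps \<open>R\<close> into
      \<plusminus>R.\<close>
    have mem: "abs_root \<Gamma> (refl \<zeta> (abs_root \<Gamma> (refl \<alpha> \<beta>))) \<in> R" if "\<beta> \<in> R" for \<beta>
    proof -
      define \<gamma> where "\<gamma> = refl \<zeta> (refl \<alpha> \<beta>)"
      have g: "\<gamma> \<in> Phi"
        unfolding \<gamma>_def using Om_Phi[OF R that] a z Phi_reflection by blast
      have "even (B \<gamma> \<delta>)" if "\<delta> \<in> R" for \<delta>
      proof -
        have z0: "B \<zeta> \<alpha> = 0"
          using 2 form_commute[of \<Gamma> \<zeta> \<alpha>] by simp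
        have "B \<gamma> \<delta> = B \<beta> \<delta> - B \<alpha> \<beta> * B \<alpha> \<delta> - B \<zeta> \<beta> * B \<zeta> \<delta>"
          by (simp add: \<gamma>_def reflection_def form_linear z0)
        moreover have "B \<beta> \<delta> = 0 \<or> B \<beta> \<delta> = 2"
          using Om_orthogonal[OF R \<open>\<beta> \<in> R\<close> that] Phi_norm[OF Om_Phi[OF R that]] by metis
        ultimately show ?thesis
          using b[OF \<open>\<beta> \<in> R\<close>] b[OF that] by auto
      qed
      then have "\<gamma> \<in> R \<or> (\<lambda>j. - \<gamma> j) \<in> R"
        by (rule even_form_imp_mem[OF R g])
      then have "abs_root \<Gamma> \<gamma> \<in> R"
        using abs_root_uminus[OF g] abs_root_id Om_Pos[OF R] by metis
      then show ?thesis
        using abs_root_Iso[OF reflection_in_Iso[OF z] Phi_reflection[OF a Om_Phi[OF R that]]]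
        by (simp add: \<gamma>_def)
    qed
    have "act (refl \<zeta>) (act (refl \<alpha>) R) \<subseteq> R"
      using mem by (auto simp: standard_action_def)
    moreover have "act (refl \<zeta>) (act (refl \<alpha>) R) \<in> Om"
      using act_Om R a z reflection_in_Iso by blast
    ultimately have "act (refl \<zeta>) (act (refl \<alpha>) R) = R"
      using R card_subset_eq[OF Om_finite[OF R]] by (auto simp: Om_iff)
    then have "act (refl \<alpha>) R = act (refl \<zeta>) R"
      using act_reflection_involution[OF z, of "act (refl \<alpha>) R"]
        act_Om[OF reflection_in_Iso[OF a] R] by (auto simp: Om_iff)
    then show ?thesis ..
  next
    case 3
    \<comment> \<open>Here \<gamma> is the sum or difference of \<zeta> and \<alpha>, so its
      products with \<open>R\<close> are even; it lies in \<plusminus>R and the reflection in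
      \<alpha> returns it to \<zeta>.\<close>
    define \<gamma> where "\<gamma> = refl \<alpha> \<zeta>"
    have g: "\<gamma> \<in> Phi"
      unfolding \<gamma>_def using a z Phi_reflection by blast
    have "even (B \<gamma> \<delta>)" if "\<delta> \<in> R" for \<delta>
      using b[OF that] 3 by (auto simp: \<gamma>_def reflection_def form_linear)
    then have "\<gamma> \<in> R \<or> (\<lambda>j. - \<gamma> j) \<in> R"
      by (rule even_form_imp_mem[OF R g])
    then have "abs_root \<Gamma> \<gamma> \<in> R"
      using abs_root_uminus[OF g] abs_root_id Om_Pos[OF R] by metis
    moreover have "abs_root \<Gamma> (refl \<alpha> (abs_root \<Gamma> \<gamma>)) = abs_root \<Gamma> \<zeta>"
      using abs_root_Iso[OF reflection_in_Iso[OF a] g] by (simp add: \<gamma>_def reflection_involution a)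
    ultimately have "abs_root \<Gamma> \<zeta> \<in> act (refl \<alpha>) R"
      unfolding standard_action_def by force
    then show ?thesis ..
  qed
qed

section \<open>Exchange for local levels\<close>

lemma lev_cong: "supp R \<alpha> = supp R \<beta> \<Longrightarrow> lev R \<alpha> = lev R \<beta>"
  by (simp add: lev_def)

lemma lev_step_le:
  assumes i: "i \<in> nodes \<Gamma>" and R: "R \<in> Om" and s: "supp R \<alpha> = supp R (simple_root i)"
  shows "\<bar>int (lev (act (sr i) R) (sr i \<alpha>)) - int (lev R \<alpha>)\<bar> \<le> 1"
proof (cases "simple_root i \<in> R")
  case True
  then show ?thesis
    by (simp add: act_fixed[OF R] lev_def supp_reflection[OF R])
next
  case False
  have "supp (act (sr i) R) (sr i \<alpha>) = supp (act (sr i) R) (sr i (simple_root i))"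
    by (simp only: supp_act[OF simple_Iso[OF i]] s)
  then have "supp (act (sr i) R) (sr i \<alpha>) = supp (act (sr i) R) (simple_root i)"
    by (simp add: simple_self i supp_uminus)
  then have "lev (act (sr i) R) (sr i \<alpha>) = lev (act (sr i) R) (simple_root i)"
    by (rule lev_cong)
  moreover have "lev R \<alpha> = lev R (simple_root i)"
    by (rule lev_cong[OF s])
  ultimately show ?thesis
    using lev_simple(1)[OF i R False] by simp
qed

text \<open>If the two sets differ, the simple reflection preserves one of the two levels and moves
  the other by at most 1, which cannot reverse a strict inequality. With different supports the
  level at \<open>R\<close> is preserved; with equal supports the simple root lies in the reflected
  set, which is then fixed.\<close>

lemma local_exchange:
  assumes i: "i \<in> nodes \<Gamma>" and R: "R \<in> Om" and a: "\<alpha> \<in> Phi"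
    and up: "lev R \<alpha> < lev (act (refl \<alpha>) R) \<alpha>"
    and down: "lev (act (sr i) (act (refl \<alpha>) R)) (sr i \<alpha>) < lev (act (sr i) R) (sr i \<alpha>)"
  shows "act (refl \<alpha>) R = act (sr i) R"
proof (rule ccontr)
  define R1 where "R1 = act (refl \<alpha>) R"
  assume ne: "act (refl \<alpha>) R \<noteq> act (sr i) R"
  have R1: "R1 \<in> Om"
    unfolding R1_def by (rule act_Om[OF reflection_in_Iso[OF a] R])
  show False
  proof (cases "supp R \<alpha> = supp R (simple_root i)")
    case False
    then have "lev (act (sr i) R) (sr i \<alpha>) = lev R \<alpha>"
      by (rule lev_invariant[OF i R])
    moreover have "\<bar>int (lev (act (sr i) R1) (sr i \<alpha>)) - int (lev R1 \<alpha>)\<bar> \<le> 1"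
      using lev_step_le[OF i R1, of \<alpha>] lev_invariant[OF i R1, of \<alpha>]
      by (cases "supp R1 \<alpha> = supp R1 (simple_root i)") simp_all
    ultimately show False
      using up down by (simp add: R1_def)
  next
    case True
    then have "abs_root \<Gamma> (simple_root i) \<in> R1"
      using three_quadruples[OF R a simple_in_Phi[OF i]] ne by (simp add: R1_def)
    then have "simple_root i \<in> R1"
      by (simp add: abs_root_id simple_in_Pos i)
    then have "lev (act (sr i) R1) (sr i \<alpha>) = lev R1 \<alpha>"
      by (simp add: act_fixed[OF R1] lev_def supp_reflection[OF R1])
    then show False
      using lev_step_le[OF i R True] up down by (simp add: R1_def)
  qed
qed

lemma rh_simple:
  assumes i: "i \<in> nodes \<Gamma>" and R: "R \<in> Om"
  shows "\<bar>rh (act (sr i) R) - rh R\<bar> \<le> 1"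
proof (cases "simple_root i \<in> R")
  case True
  then show ?thesis
    by (simp add: act_fixed[OF R])
next
  case False
  then show ?thesis
    using rh_step[OF i R] lev_simple(1)[OF i R] by simp
qed

section \<open>Minimal sets and their uniqueness\<close>

definition minimal :: "vec set \<Rightarrow> bool" where
  "minimal R \<longleftrightarrow> R \<in> Om \<and> (\<forall>i\<in>nodes \<Gamma>. rh R \<le> rh (act (sr i) R))"

text \<open>The level of the simple root has to change and may not drop, so it rises. If the product
  is nonzero, \<open>top\<close> makes \<beta> the highest element of the support, and the sign
  claim of \<open>lev_simple\<close> applies.\<close>

lemma minimal_simple:
  assumes R: "minimal R" and i: "i \<in> nodes \<Gamma>" and b: "\<beta> \<in> R"
    and top: "\<And>\<gamma>. \<gamma> \<in> R \<Longrightarrow> h \<beta> < h \<gamma> \<Longrightarrow> B (simple_root i) \<gamma> = 0"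
  shows "B (simple_root i) \<beta> \<ge> 0"
proof (cases "simple_root i \<in> R")
  case True
  then show ?thesis
    using R b Om_orthogonal[OF _ True b] form_simple_root_self[OF finite_nodes i]
    by (cases "simple_root i = \<beta>") (auto simp: minimal_def)
next
  case False
  have Om: "R \<in> Om"
    using R by (simp add: minimal_def)
  have "rh R \<le> rh (act (sr i) R)"
    using R i by (simp add: minimal_def)
  then have up: "lev R (simple_root i) < lev (act (sr i) R) (simple_root i)"
    using rh_step[OF i Om False] lev_simple(1)[OF i Om False] by linarith
  show ?thesis
  proof (cases "B (simple_root i) \<beta> = 0")
    case nz: False
    have "h \<gamma> \<le> h \<beta>" if "\<gamma> \<in> supp R (simple_root i)" for \<gamma>
      using top[of \<gamma>] that by (force simp: supp_def)
    then show ?thesis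
      using lev_simple(2)[OF i Om False up, of \<beta>] nz b by (simp add: supp_def)
  qed simp
qed

text \<open>The elements of a minimal \<open>R\<close>, in decreasing order of height, form Kostant's cascade: each
  is dominant for the roots orthogonal to all higher elements.\<close>

lemma minimal_dominant:
  assumes R: "minimal R" and g: "\<gamma> \<in> Pos" and b: "\<beta> \<in> R"
    and top: "\<And>\<delta>. \<delta> \<in> R \<Longrightarrow> h \<beta> < h \<delta> \<Longrightarrow> B \<gamma> \<delta> = 0"
  shows "B \<gamma> \<beta> \<ge> 0"
proof -
  have Om: "R \<in> Om"
    using R by (simp add: minimal_def)
  \<comment> \<open>Starting from the highest elements, \<open>B \<gamma> \<delta> = 0\<close> is a
    sum of nonnegative contributions of the simple roots in \<gamma>, so each contribution
    vanishes.\<close>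
  have orth: "B (simple_root i) \<delta> = 0"
    if "\<delta> \<in> R" "h \<beta> < h \<delta>" "i \<in> nodes \<Gamma>" "\<gamma> i \<noteq> 0" for \<delta> i
    using that
  proof (induction "card {\<epsilon> \<in> R. h \<delta> < h \<epsilon>}" arbitrary: \<delta> i rule: less_induct)
    case less
    have nn: "\<gamma> k * B (simple_root k) \<delta> \<ge> 0" if k: "k \<in> nodes \<Gamma>" for k
    proof (cases "\<gamma> k = 0")
      case False
      have "B (simple_root k) \<epsilon> = 0" if e: "\<epsilon> \<in> R" "h \<delta> < h \<epsilon>" for \<epsilon>
      proof (rule less.hyps[OF _ e(1) _ k False])
        have "{x \<in> R. h \<epsilon> < h x} \<subset> {x \<in> R. h \<delta> < h x}"
          using e by auto
        then show "card {x \<in> R. h \<epsilon> < h x} < card {x \<in> R. h \<delta> < h x}"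
          using Om_finite[OF Om] by (intro psubset_card_mono) auto
        show "h \<beta> < h \<epsilon>"
          using e(2) less.prems(2) by simp
      qed
      then have "B (simple_root k) \<delta> \<ge> 0"
        by (rule minimal_simple[OF R k less.prems(1)])
      then show ?thesis
        using Pos_nonneg[OF g] by simp
    qed simp
    have "(\<Sum>k\<in>nodes \<Gamma>. \<gamma> k * B (simple_root k) \<delta>) = 0"
      using top[OF less.prems(1,2)] form_expand_left[OF finite_nodes] by metis
    then have "\<gamma> i * B (simple_root i) \<delta> = 0"
      using sum_nonneg_eq_0_iff[OF finite_nodes, of "\<lambda>k. \<gamma> k * B (simple_root k) \<delta>"] nn less.prems(3) by blast
    then show ?case
      using less.prems(4) by simp
  qed
  have "\<gamma> k * B (simple_root k) \<beta> \<ge> 0" if k: "k \<in> nodes \<Gamma>" for k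
  proof (cases "\<gamma> k = 0")
    case False
    then show ?thesis
      using minimal_simple[OF R k b] orth[OF _ _ k] Pos_nonneg[OF g] by simp
  qed simp
  then show ?thesis
    unfolding form_expand_left[OF finite_nodes, of \<gamma>] by (intro sum_nonneg)
qed

lemma ex_highest:
  assumes "finite A" "A \<noteq> {}"
  obtains \<beta> where "\<beta> \<in> A" "\<And>\<epsilon>. \<epsilon> \<in> A \<Longrightarrow> h \<epsilon> \<le> h \<beta>"
proof -
  have "Max (h ` A) \<in> h ` A"
    using assms by (intro Max_in) auto
  then obtain \<beta> where b: "\<beta> \<in> A" "Max (h ` A) = h \<beta>"
    by blast
  have "h \<epsilon> \<le> h \<beta>" if "\<epsilon> \<in> A" for \<epsilon>
    using assms(1) that Max_ge[of "h ` A" "h \<epsilon>"] unfolding b(2) by blast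
  with b(1) show ?thesis
    by (rule that)
qed

lemma supp_highest:
  assumes R: "R \<in> Om" and g: "\<gamma> \<in> Phi"
  obtains \<delta> where "\<delta> \<in> R" "B \<gamma> \<delta> \<noteq> 0" "\<And>\<epsilon>. \<epsilon> \<in> R \<Longrightarrow> h \<delta> < h \<epsilon> \<Longrightarrow> B \<gamma> \<epsilon> = 0"
proof -
  have f: "finite (supp R \<gamma>)"
    using Om_finite[OF R] supp_subset finite_subset by blast
  have "supp R \<gamma> \<noteq> {}"
    using supp_cases[OF R g] supp_self[OF R, of \<gamma>] by force
  then obtain \<delta> where "\<delta> \<in> supp R \<gamma>" "\<And>\<epsilon>. \<epsilon> \<in> supp R \<gamma> \<Longrightarrow> h \<epsilon> \<le> h \<delta>"
    using ex_highest[OF f] by blast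
  then show ?thesis
    by (intro that[of \<delta>]) (force simp: supp_def)+
qed

lemma form_eq_1:
  assumes "u \<in> Pos" "v \<in> Pos" "u \<noteq> v" "B u v \<ge> 0" "B u v \<noteq> 0"
  shows "B u v = 1"
  using form_bounds(2,3)[of u v] assms Pos_in_Phi by fastforce

text \<open>Let \<open>d\<close> be the highest element in the support of a residual \<gamma>.
  Dominance gives the product 1, so \<open>refl d \<gamma>\<close> is \<gamma> - d. This is positive
  and orthogonal to everything above \<open>d\<close>, but has product -1 with \<open>d\<close>,
  against dominance. So local minimality is global: \<open>rho\<close> is 0.\<close>

lemma minimal_Rs_empty:
  assumes R: "minimal R"
  shows "Rs R = {}"
proof (rule ccontr)
  assume "Rs R \<noteq> {}"
  then obtain \<gamma> where g: "\<gamma> \<in> Pos" "\<And>\<beta>. \<beta> \<in> R \<Longrightarrow> refl \<beta> \<gamma> \<in> Pos"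
    using Rs_iff by blast
  have Om: "R \<in> Om"
    using R by (simp add: minimal_def)
  obtain d where d: "d \<in> R" "B \<gamma> d \<noteq> 0" "\<And>\<epsilon>. \<epsilon> \<in> R \<Longrightarrow> h d < h \<epsilon> \<Longrightarrow> B \<gamma> \<epsilon> = 0"
    using supp_highest[OF Om Pos_in_Phi[OF g(1)]] by blast
  have dP: "d \<in> Pos"
    using Om_Pos[OF Om d(1)] .
  have "\<gamma> \<noteq> d"
  proof
    assume "\<gamma> = d"
    then have "refl d \<gamma> = (\<lambda>j. - d j)"
      using Phi_norm[OF Pos_in_Phi[OF dP]] by (simp add: reflection_def)
    then show False
      using g(2)[OF d(1)] uminus_Pos[OF dP] by simp
  qed
  then have 1: "B \<gamma> d = 1"
    using form_eq_1[OF g(1) dP _ minimal_dominant[OF R g(1) d(1) d(3)] d(2)] by blast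
  have "B (refl d \<gamma>) d \<ge> 0"
  proof (rule minimal_dominant[OF R g(2)[OF d(1)] d(1)])
    fix e
    assume "e \<in> R" "h d < h e"
    then show "B (refl d \<gamma>) e = 0"
      using d(3) Om_orthogonal[OF Om d(1), of e] by (auto simp: reflection_def form_linear)
  qed
  then show False
    using 1 Phi_norm[OF Pos_in_Phi[OF dP]] form_commute[of \<Gamma> d \<gamma>]
    by (simp add: reflection_def form_linear)
qed

text \<open>Otherwise let \<open>d\<close> be the highest element of \<open>R'\<close> in the
  support of \<beta>; their product is 1. If \<beta> - d is positive, it violates dominance in
  \<open>R'\<close> at \<open>d\<close>; if negative, d - \<beta> violates dominance in
  \<open>R\<close> at \<beta>.\<close>

lemma minimal_subset:
  assumes R: "minimal R" and R': "minimal R'" and b: "\<beta> \<in> R"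
    and top: "\<And>\<epsilon>. \<epsilon> \<in> R \<Longrightarrow> h \<beta> < h \<epsilon> \<Longrightarrow> \<epsilon> \<in> R'"
  shows "\<beta> \<in> R'"
proof (rule ccontr)
  assume n: "\<beta> \<notin> R'"
  have Om: "R \<in> Om" "R' \<in> Om"
    using R R' by (simp_all add: minimal_def)
  have bP: "\<beta> \<in> Pos"
    using Om_Pos[OF Om(1) b] .
  obtain d where d: "d \<in> R'" "B \<beta> d \<noteq> 0" "\<And>\<epsilon>. \<epsilon> \<in> R' \<Longrightarrow> h d < h \<epsilon> \<Longrightarrow> B \<beta> \<epsilon> = 0"
    using supp_highest[OF Om(2) Pos_in_Phi[OF bP]] by blast
  have dP: "d \<in> Pos"
    using Om_Pos[OF Om(2) d(1)] .
  have bd: "B \<beta> d = 1"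
    using form_eq_1[OF bP dP _ minimal_dominant[OF R' bP d(1) d(3)] d(2)] n d(1) by blast
  then have db: "B d \<beta> = 1"
    using form_commute[of \<Gamma> d \<beta>] by simp
  have n2: "B d d = 2" "B \<beta> \<beta> = 2"
    using Phi_norm Pos_in_Phi dP bP by auto
  have "refl d \<beta> \<in> Phi"
    using Phi_reflection Pos_in_Phi dP bP by blast
  then consider "refl d \<beta> \<in> Pos" | "(\<lambda>j. - refl d \<beta> j) \<in> Pos"
    using Pos_or_uminus by blast
  then show False
  proof cases
    case 1
    have "B (refl d \<beta>) d \<ge> 0"
    proof (rule minimal_dominant[OF R' 1 d(1)])
      fix e
      assume "e \<in> R'" "h d < h e"
      then show "B (refl d \<beta>) e = 0"
        using d(3) Om_orthogonal[OF Om(2) d(1), of e] by (auto simp: reflection_def form_linear)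
    qed
    then show False
      using bd db n2 by (simp add: reflection_def form_linear)
  next
    case 2
    have "B (\<lambda>j. - refl d \<beta> j) \<beta> \<ge> 0"
    proof (rule minimal_dominant[OF R 2 b])
      fix e
      assume e: "e \<in> R" "h \<beta> < h e"
      \<comment> \<open>The agreement above \<beta> enters here: \<open>e\<close> lies in
        \<open>R'\<close> and is not \<open>d\<close>, so it is orthogonal to \<open>d\<close> as
        well as to \<beta>.\<close>
      then have e': "e \<in> R'" "B \<beta> e = 0"
        using top Om_orthogonal[OF Om(1) b, of e] by auto
      then have "e \<noteq> d"
        using bd by auto
      with e' show "B (\<lambda>j. - refl d \<beta> j) e = 0"
        using Om_orthogonal[OF Om(2) d(1), of e] by (simp add: reflection_def form_linear)
    qed
    then show False
      using bd db n2 by (simp add: reflection_def form_linear)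
  qed
qed

text \<open>Above the highest element of the symmetric difference both sets agree, and
  \<open>minimal_subset\<close> applies from whichever side contains that element.\<close>

lemma minimal_unique:
  assumes R: "minimal R" "minimal R'"
  shows "R = R'"
proof (rule ccontr)
  assume ne: "R \<noteq> R'"
  have fin: "finite ((R - R') \<union> (R' - R))"
    using R Om_finite by (auto simp: minimal_def)
  have "(R - R') \<union> (R' - R) \<noteq> {}"
    using ne by auto
  then obtain \<beta> where b: "\<beta> \<in> (R - R') \<union> (R' - R)" "\<And>\<epsilon>. \<epsilon> \<in> (R - R') \<union> (R' - R) \<Longrightarrow> h \<epsilon> \<le> h \<beta>"
    using ex_highest[OF fin] by blast
  have "\<epsilon> \<in> R \<longleftrightarrow> \<epsilon> \<in> R'" if "h \<beta> < h \<epsilon>" for \<epsilon>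
    using b(2)[of \<epsilon>] that by auto
  then show False
    using b(1) minimal_subset[OF R, of \<beta>] minimal_subset[OF R(2,1), of \<beta>] by blast
qed

text \<open>A minimal \<open>R\<close> has level 0, which cannot drop. Otherwise some simple
  reflection lowers \<open>rho\<close>. If the images under it compare as before, the induction
  hypothesis applies to them, and reflecting \<open>R1\<close> changes \<open>rho\<close> by at most
  1. If the comparison is reversed, exchange shows that both reflections send \<open>R\<close> to
  the same set.\<close>

lemma lev_decrease:
  assumes "R \<in> Om" "\<alpha> \<in> Phi" "lev (act (refl \<alpha>) R) \<alpha> < lev R \<alpha>"
  shows "rh (act (refl \<alpha>) R) < rh R"
  using assms
proof (induction "card (Rs R)" arbitrary: R \<alpha> rule: less_induct)
  case less
  note R = less.prems(1) and a = less.prems(2)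
  have "\<not> minimal R"
  proof
    assume "minimal R"
    then have "lev R \<alpha> = 0"
      using minimal_Rs_empty by (simp add: lev_def Rq_def)
    then show False
      using less.prems(3) by simp
  qed
  then obtain i where i: "i \<in> nodes \<Gamma>" and lt: "rh (act (sr i) R) < rh R"
    using R by (auto simp: minimal_def not_le)
  define R' where "R' = act (sr i) R"
  define R1 where "R1 = act (refl \<alpha>) R"
  have R': "R' \<in> Om" and R1: "R1 \<in> Om"
    unfolding R'_def R1_def using act_Om R reflection_in_Iso a simple_in_Phi[OF i] by blast+
  have a': "sr i \<alpha> \<in> Phi"
    using Phi_reflection simple_in_Phi[OF i] a by blast
  have conj: "act (sr i) R1 = act (refl (sr i \<alpha>)) R'"
    unfolding R1_def R'_def by (rule act_conjugate[OF simple_Iso[OF i] a Om_subset_Phi[OF R]])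
  show ?case
  proof (cases "lev (act (sr i) R1) (sr i \<alpha>) < lev R' (sr i \<alpha>)")
    case True
    have "card (Rs R') < card (Rs R)"
      using lt by (simp add: rho_def R'_def)
    then have "rh (act (sr i) R1) < rh R'"
      using less.hyps[OF _ R' a'] True unfolding conj by blast
    then show ?thesis
      using rh_simple[OF i R1] lt by (simp add: R1_def R'_def)
  next
    case False
    have "lev (act (sr i) R1) (sr i \<alpha>) \<noteq> lev R' (sr i \<alpha>)"
    proof
      assume "lev (act (sr i) R1) (sr i \<alpha>) = lev R' (sr i \<alpha>)"
      then have "act (sr i) R1 = R'"
        using lev_neq[OF R' a'] act_fixed[OF R'] unfolding conj by blast
      then have "act (sr i) (act (sr i) R1) = act (sr i) (act (sr i) R)"
        by (simp add: R'_def)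
      then have "R1 = R"
        using act_reflection_involution[OF simple_in_Phi[OF i]] R R1 by (simp add: Om_iff)
      then show False
        using less.prems(3) by (simp add: R1_def)
    qed
    with False have l: "lev R' (sr i \<alpha>) < lev (act (sr i) R1) (sr i \<alpha>)"
      by simp
    have ret: "act (refl \<alpha>) R1 = R"
      unfolding R1_def using act_reflection_involution[OF a] R by (simp add: Om_iff)
    \<comment> \<open>Exchange is used at \<open>R1\<close>, from where the reflection in \<alpha>
      raises the level back to that of \<open>R\<close>.\<close>
    have "act (refl \<alpha>) R1 = act (sr i) R1"
      using local_exchange[OF i R1 a] less.prems(3) l unfolding ret by (simp add: R1_def R'_def)
    then have "act (sr i) R = R1"
      using act_reflection_involution[OF simple_in_Phi[OF i], of R1] R1 unfolding ret by (simp add: Om_iff)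
    then show ?thesis
      using lt by (simp add: R1_def)
  qed
qed

lemma lev_eq_imp_fixed:
  assumes "R \<in> Om" "\<alpha> \<in> Phi" "lev (act (refl \<alpha>) R) \<alpha> = lev R \<alpha>"
  shows "act (refl \<alpha>) R = R"
  using lev_neq[OF assms(1,2)] act_fixed[OF assms(1)] assms(3) by blast

text \<open>If the level did not drop it would rise, and \<open>lev_decrease\<close> at the
  reflected set would give the opposite inequality for \<open>rho\<close>.\<close>

lemma rh_less_imp_lev_less:
  assumes R: "R \<in> Om" and a: "\<alpha> \<in> Phi" and lt: "rh (act (refl \<alpha>) R) < rh R"
  shows "lev (act (refl \<alpha>) R) \<alpha> < lev R \<alpha>"
proof (rule ccontr)
  assume "\<not> ?thesis"
  moreover have "lev (act (refl \<alpha>) R) \<alpha> \<noteq> lev R \<alpha>"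
    using lev_eq_imp_fixed[OF R a] lt by fastforce
  ultimately have "lev (act (refl \<alpha>) (act (refl \<alpha>) R)) \<alpha> < lev (act (refl \<alpha>) R) \<alpha>"
    using act_reflection_involution[OF a] R by (simp add: Om_iff)
  then have "rh (act (refl \<alpha>) (act (refl \<alpha>) R)) < rh (act (refl \<alpha>) R)"
    by (rule lev_decrease[OF act_Om[OF reflection_in_Iso[OF a] R] a])
  then show False
    using lt act_reflection_involution[OF a] R by (simp add: Om_iff)
qed

lemma rh_eq_imp_fixed:
  assumes R: "R \<in> Om" and a: "\<alpha> \<in> Phi" and eq: "rh (act (refl \<alpha>) R) = rh R"
  shows "act (refl \<alpha>) R = R"
proof (rule lev_eq_imp_fixed[OF R a], rule ccontr)
  define R1 where "R1 = act (refl \<alpha>) R"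
  have R1: "R1 \<in> Om" "act (refl \<alpha>) R1 = R"
    unfolding R1_def using act_Om[OF reflection_in_Iso[OF a] R] act_reflection_involution[OF a] R
    by (simp_all add: Om_iff)
  assume "lev (act (refl \<alpha>) R) \<alpha> \<noteq> lev R \<alpha>"
  then consider "lev R1 \<alpha> < lev R \<alpha>" | "lev R \<alpha> < lev R1 \<alpha>"
    unfolding R1_def by linarith
  then show False
  proof cases
    case 1
    then show False
      using lev_decrease[OF R a] eq by (simp add: R1_def)
  next
    case 2
    then show False
      using lev_decrease[OF R1(1) a] eq R1 by (simp add: R1_def)
  qed
qed

lemma rh_exchange:
  assumes i: "i \<in> nodes \<Gamma>" and R: "R \<in> Om" and a: "\<alpha> \<in> Phi"
    and up: "rh R < rh (act (refl \<alpha>) R)"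
    and down: "rh (act (sr i) (act (refl \<alpha>) R)) < rh (act (sr i) R)"
  shows "act (refl \<alpha>) R = act (sr i) R"
proof (rule local_exchange[OF i R a])
  have R1: "act (refl \<alpha>) R \<in> Om" "act (refl \<alpha>) (act (refl \<alpha>) R) = R"
    using act_Om[OF reflection_in_Iso[OF a] R] act_reflection_involution[OF a] R by (simp_all add: Om_iff)
  then show "lev R \<alpha> < lev (act (refl \<alpha>) R) \<alpha>"
    using rh_less_imp_lev_less[OF R1(1) a] up by simp
  have "act (sr i) (act (refl \<alpha>) R) = act (refl (sr i \<alpha>)) (act (sr i) R)"
    by (rule act_conjugate[OF simple_Iso[OF i] a Om_subset_Phi[OF R]])
  then show "lev (act (sr i) (act (refl \<alpha>) R)) (sr i \<alpha>) < lev (act (sr i) R) (sr i \<alpha>)"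
    using rh_less_imp_lev_less[OF act_Om[OF simple_Iso[OF i] R] Phi_reflection[OF simple_in_Phi[OF i] a]] down
    by simp
qed

text \<open>Group elements are recorded in both directions, so that two descents can be joined
  without inverses.\<close>

lemma reaches_minimal:
  assumes "R \<in> Om"
  shows "\<exists>M. minimal M \<and> (\<exists>v\<in>carrier W. act v R = M) \<and> (\<exists>w\<in>carrier W. act w M = R)"
  using assms
proof (induction "card (Rs R)" arbitrary: R rule: less_induct)
  case less
  note R = less.prems
  have idR: "act id R = R"
    using act_id R by (simp add: Om_iff)
  show ?case
  proof (cases "minimal R")
    case True
    then show ?thesis
      using id_in_W idR by blast
  next
    case False
    then obtain i where i: "i \<in> nodes \<Gamma>" and lt: "rh (act (sr i) R) < rh R"
      using R by (auto simp: minimal_def not_le)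
    define R' where "R' = act (sr i) R"
    have R': "R' \<in> Om" "act (sr i) R' = R"
      unfolding R'_def using act_Om[OF simple_Iso[OF i] R] act_reflection_involution[OF simple_in_Phi[OF i]] R
      by (simp_all add: Om_iff)
    have "card (Rs R') < card (Rs R)"
      using lt by (simp add: rho_def R'_def)
    then obtain M v w where M: "minimal M" and v: "v \<in> carrier W" "act v R' = M"
      and w: "w \<in> carrier W" "act w M = R'"
      using less.hyps R'(1) by blast
    have "act (v \<circ> sr i) R = M"
      using act_comp[OF W_in_Iso[OF v(1)] simple_Iso[OF i] Om_subset_Phi[OF R]] v(2) by (simp add: R'_def)
    moreover have "act (sr i \<circ> w) M = R"
      using act_comp[OF simple_Iso[OF i] W_in_Iso[OF w(1)] Om_subset_Phi[of M]] M w(2) R'(2)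
      by (simp add: minimal_def)
    ultimately show ?thesis
      using M comp_in_W simple_in_W[OF i] v(1) w(1) by blast
  qed
qed

lemma transitive:
  assumes "R \<in> Om" "R' \<in> Om"
  shows "\<exists>w\<in>carrier W. act w R = R'"
proof -
  obtain M v where M: "minimal M" "v \<in> carrier W" "act v R = M"
    using reaches_minimal[OF assms(1)] by blast
  obtain M' w where M': "minimal M'" "w \<in> carrier W" "act w M' = R'"
    using reaches_minimal[OF assms(2)] by blast
  have "M = M'"
    using minimal_unique M(1) M'(1) by blast
  then have "act (w \<circ> v) R = R'"
    using act_comp[OF W_in_Iso[OF M'(2)] W_in_Iso[OF M(2)] Om_subset_Phi[OF assms(1)]] M M' by simp
  then show ?thesis
    using comp_in_W M(2) M'(2) by blast
qed

section \<open>The action as a homomorphism and the reflections of the Coxeter system\<close>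

abbreviation phi where "phi \<equiv> Omega_action \<Gamma> (positive_roots \<Gamma>)"

lemma phi_apply: "R \<in> Om \<Longrightarrow> phi w R = act w R"
  by (simp add: Omega_action_def)

lemma W_inverse:
  assumes "w \<in> carrier W"
  shows "inv\<^bsub>W\<^esub> w \<in> carrier W" "w \<circ> inv\<^bsub>W\<^esub> w = id" "inv\<^bsub>W\<^esub> w \<circ> w = id"
  using assms W_mult W_one group.inv_closed[OF W_group assms] group.r_inv[OF W_group assms] group.l_inv[OF W_group assms]
  by metis+

lemma phi_Bij:
  assumes w: "w \<in> carrier W"
  shows "phi w \<in> Bij Om"
proof -
  note inv = W_inverse[OF w]
  have c: "act u (act v R) = R" if "u \<in> carrier W" "v \<in> carrier W" "u \<circ> v = id" "R \<in> Om" for u v R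
    using act_comp[OF W_in_Iso[OF that(1)] W_in_Iso[OF that(2)] Om_subset_Phi[OF that(4)]] that act_id[of R]
    by (simp add: Om_iff)
  have "bij_betw (act w) Om Om"
    by (rule bij_betwI[where g = "act (inv\<^bsub>W\<^esub> w)"]) (use c inv w act_Om W_in_Iso in auto)
  then show ?thesis
    by (simp add: Bij_def Omega_action_def bij_betw_restrict_eq)
qed

lemma phi_action: "group_action W Om phi"
  unfolding group_action_def
proof (rule group_hom.intro[OF W_group group_BijGroup group_hom_axioms.intro])
  show "phi \<in> hom W (BijGroup Om)"
  proof (rule homI)
    fix v w
    assume v: "v \<in> carrier W" and w: "w \<in> carrier W"
    show "phi v \<in> carrier (BijGroup Om)"
      using phi_Bij[OF v] by (simp add: BijGroup_def)
    have "phi (v \<circ> w) R = compose Om (phi v) (phi w) R" for R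
      using act_comp[OF W_in_Iso[OF v] W_in_Iso[OF w] Om_subset_Phi, of R] act_Om[OF W_in_Iso[OF w], of R]
      by (cases "R \<in> Om") (simp_all add: compose_def Omega_action_def)
    then have "phi (v \<circ> w) = compose Om (phi v) (phi w)"
      by blast
    then show "phi (v \<otimes>\<^bsub>W\<^esub> w) = phi v \<otimes>\<^bsub>BijGroup Om\<^esub> phi w"
      using phi_Bij[OF v] phi_Bij[OF w] by (simp add: W_mult v w BijGroup_def)
  qed
qed

text \<open>Conjugating a reflection by an isometry \<open>w\<close> gives the reflection in the
  image of its root under \<open>w\<close>.\<close>

lemma coxeter_reflection_root:
  assumes "r \<in> coxeter_reflections W (simple_reflections \<Gamma>)"
  obtains \<alpha> where "\<alpha> \<in> Phi" "r = refl \<alpha>"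
proof -
  obtain w i where w: "w \<in> carrier W" and i: "i \<in> nodes \<Gamma>" and r: "r = w \<otimes>\<^bsub>W\<^esub> sr i \<otimes>\<^bsub>W\<^esub> inv\<^bsub>W\<^esub> w"
    using assms by (auto simp: coxeter_reflections_def simple_reflections_def)
  note inv = W_inverse[OF w]
  have "r = w \<circ> sr i \<circ> inv\<^bsub>W\<^esub> w"
    using r w inv(1) simple_in_W[OF i] comp_in_W by (simp add: W_mult)
  moreover have "w (sr i ((inv\<^bsub>W\<^esub> w) v)) = refl (w (simple_root i)) v" for v
    using Iso_reflection[OF W_in_Iso[OF w], of "simple_root i" "(inv\<^bsub>W\<^esub> w) v"] fun_cong[OF inv(2), of v] by simp
  ultimately have "r = refl (w (simple_root i))"
    by (simp add: fun_eq_iff)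
  then show ?thesis
    using that Iso_Phi[OF W_in_Iso[OF w] simple_in_Phi[OF i]] by blast
qed

theorem transitive_QP: "transitive_QP_triple \<Gamma> (simple_reflections \<Gamma>) (positive_roots \<Gamma>)"
proof -
  have "quasiparabolic W (simple_reflections \<Gamma>) Om phi rh"
    unfolding quasiparabolic_def scaled_set_def
  proof (intro conjI ballI impI phi_action)
    fix s R
    assume "s \<in> simple_reflections \<Gamma>" "R \<in> Om"
    then show "\<bar>rh (phi s R) - rh R\<bar> \<le> 1"
      using rh_simple by (auto simp: simple_reflections_def phi_apply)
  next
    fix r R
    assume r: "r \<in> coxeter_reflections W (simple_reflections \<Gamma>)" and R: "R \<in> Om" "rh (phi r R) = rh R"
    obtain \<alpha> where "\<alpha> \<in> Phi" "r = refl \<alpha>"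
      using coxeter_reflection_root[OF r] .
    then show "phi r R = R"
      using R rh_eq_imp_fixed by (simp add: phi_apply)
  next
    fix r s R
    assume r: "r \<in> coxeter_reflections W (simple_reflections \<Gamma>)" and s: "s \<in> simple_reflections \<Gamma>"
      and R: "R \<in> Om" and l: "rh (phi r R) > rh R \<and> rh (phi s (phi r R)) < rh (phi s R)"
    obtain \<alpha> where a: "\<alpha> \<in> Phi" "r = refl \<alpha>"
      using coxeter_reflection_root[OF r] .
    obtain i where i: "i \<in> nodes \<Gamma>" "s = sr i"
      using s by (auto simp: simple_reflections_def)
    show "phi r R = phi s R"
      using rh_exchange[OF i(1) R a(1)] l R a i act_Om[OF reflection_in_Iso[OF a(1)] R]
      by (simp add: phi_apply)
  qed
  moreover have "transitive_action W Om phi"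
    by (intro transitive_action.intro transitive_action_axioms.intro phi_action)
      (use transitive in \<open>simp add: phi_apply\<close>)
  ultimately show ?thesis
    by (simp add: transitive_QP_triple_def QP_triple_def)
qed

end

section \<open>Types E and D\<close>

text \<open>In type D twice a simple root needs at most four elements of the frame. The four vectors
  may coincide, since their coefficients are added.\<close>

lemma span4:
  fixes b1 b2 b3 b4 :: vec
  assumes "finite A" "b1 \<in> A" "b2 \<in> A" "b3 \<in> A" "b4 \<in> A"
    and v: "\<And>j. v j = c1 * b1 j + c2 * b2 j + c3 * b3 j + c4 * b4 j"
  shows "\<exists>f. \<forall>j. v j = (\<Sum>\<beta>\<in>A. f \<beta> * \<beta> j)"
proof (intro exI allI)
  fix j
  have d: "(\<Sum>\<beta>\<in>A. (if \<beta> = b then c else 0) * \<beta> j) = c * b j" if "b \<in> A" for b c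
  proof -
    have "(\<Sum>\<beta>\<in>A. (if \<beta> = b then c else 0) * \<beta> j) = (\<Sum>\<beta>\<in>A. if \<beta> = b then c * b j else 0)"
      by (intro sum.cong) auto
    then show ?thesis
      using assms(1) that by simp
  qed
  show "v j = (\<Sum>\<beta>\<in>A. ((if \<beta> = b1 then c1 else 0) + (if \<beta> = b2 then c2 else 0) +
      (if \<beta> = b3 then c3 else 0) + (if \<beta> = b4 then c4 else 0)) * \<beta> j)"
    unfolding v distrib_right sum.distrib using assms by (simp only: d)
qed

text \<open>Nodes are numbered from 1, list positions from 0.\<close>

definition list_vec :: "int list \<Rightarrow> vec" where
  "list_vec xs i = (if 1 \<le> i \<and> i \<le> length xs then xs ! (i - 1) else 0)"

text \<open>All conditions become numerical identities for finitely many coordinates. Distinct lists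
  give distinct vectors because their product is 0 and not 2, so the sum over the list is the sum
  over the set.\<close>

lemma orthogonal_frame_of_list:
  fixes L :: "int list list"
  assumes nodes: "nodes \<Gamma> = {1..n}" and L: "L \<noteq> []" "distinct L"
    and len: "\<And>xs. xs \<in> set L \<Longrightarrow> length xs = n" and nn: "\<And>xs x. xs \<in> set L \<Longrightarrow> x \<in> set xs \<Longrightarrow> 0 \<le> x"
    and f: "\<And>xs ys. xs \<in> set L \<Longrightarrow> ys \<in> set L \<Longrightarrow>
      form \<Gamma> (list_vec xs) (list_vec ys) = (if xs = ys then 2 else 0)"
    and span: "\<And>i j. i \<in> nodes \<Gamma> \<Longrightarrow> j \<in> nodes \<Gamma> \<Longrightarrow>
      2 * simple_root i j = (\<Sum>xs\<leftarrow>L. form \<Gamma> (simple_root i) (list_vec xs) * list_vec xs j)"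
  shows "orthogonal_frame \<Gamma> (list_vec ` set L)"
proof
  show "finite (nodes \<Gamma>)" "finite (list_vec ` set L)" "list_vec ` set L \<noteq> {}"
    using nodes L by simp_all
  fix \<beta> i
  assume "\<beta> \<in> list_vec ` set L"
  then obtain xs where xs: "xs \<in> set L" "\<beta> = list_vec xs"
    by blast
  show "supported \<Gamma> \<beta>"
    using xs len by (auto simp: supported_def list_vec_def nodes)
  show "0 \<le> \<beta> i"
    using xs(2) by (auto simp: list_vec_def intro!: nn[OF xs(1)] nth_mem)
  show "form \<Gamma> \<beta> \<beta> = 2"
    using xs f by simp
next
  show "orthogonal_set \<Gamma> (list_vec ` set L)"
    using f by (auto simp: orthogonal_set_def pairwise_def)
next
  fix i
  assume i: "i \<in> nodes \<Gamma>"
  have inj: "inj_on list_vec (set L)"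
  proof (rule inj_onI, rule ccontr)
    fix xs ys
    assume "xs \<in> set L" "ys \<in> set L" "list_vec xs = list_vec ys" "xs \<noteq> ys"
    then show False
      using f[of xs ys] f[of ys ys] by simp
  qed
  have "2 * simple_root i j = (\<Sum>\<beta>\<in>list_vec ` set L. form \<Gamma> (simple_root i) \<beta> * \<beta> j)" for j
  proof (cases "j \<in> nodes \<Gamma>")
    case True
    then show ?thesis
      by (simp add: sum.reindex[OF inj] span[OF i] sum_list_distinct_conv_sum_set[OF L(2)])
  next
    case False
    then have "list_vec xs j = 0" if "xs \<in> set L" for xs
      using len[OF that] by (auto simp: list_vec_def nodes)
    then show ?thesis
      using False i by (auto simp: sum.reindex[OF inj] simple_root_def)
  qed
  then show "\<exists>f. \<forall>j. 2 * simple_root i j = (\<Sum>\<beta>\<in>list_vec ` set L. f \<beta> * \<beta> j)"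
    by blast
qed

section \<open>Type E\<close>

lemma nodes_E: "nodes (diagram_E n) = {1..n}"
  by (simp add: diagram_E_def)

lemma edge_E_iff: "{i, j} \<in> edges (diagram_E n) \<longleftrightarrow>
    3 \<le> i \<and> j = i + 1 \<and> j \<le> n \<or> 3 \<le> j \<and> i = j + 1 \<and> i \<le> n \<or>
    i = 1 \<and> j = 3 \<or> i = 3 \<and> j = 1 \<or> i = 2 \<and> j = 4 \<or> i = 4 \<and> j = 2"
  by (auto simp: diagram_E_def doubleton_eq_iff)

lemma nodes_E7: "nodes (diagram_E 7) = {1, 2, 3, 4, 5, 6, 7}"
  by (auto simp: nodes_E)

lemma form_E7: "form (diagram_E 7) u v = 2 * (u 1 * v 1 + u 2 * v 2 + u 3 * v 3 + u 4 * v 4 + u 5 * v 5 + u 6 * v 6 + u 7 * v 7) -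
    u 3 * v 4 - u 4 * v 3 - u 4 * v 5 - u 5 * v 4 - u 5 * v 6 - u 6 * v 5 - u 6 * v 7 - u 7 * v 6 - u 1 * v 3 - u 3 * v 1 - u 2 * v 4 - u 4 * v 2"
  by (simp add: form_def nodes_E7 cartan_def edge_E_iff algebra_simps)

lemma nodes_E8: "nodes (diagram_E 8) = {1, 2, 3, 4, 5, 6, 7, 8}"
  by (auto simp: nodes_E)

lemma form_E8: "form (diagram_E 8) u v = 2 * (u 1 * v 1 + u 2 * v 2 + u 3 * v 3 + u 4 * v 4 + u 5 * v 5 + u 6 * v 6 + u 7 * v 7 + u 8 * v 8) -
    u 3 * v 4 - u 4 * v 3 - u 4 * v 5 - u 5 * v 4 - u 5 * v 6 - u 6 * v 5 - u 6 * v 7 - u 7 * v 6 - u 7 * v 8 - u 8 * v 7 - u 1 * v 3 - u 3 * v 1 - u 2 * v 4 - u 4 * v 2"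
  by (simp add: form_def nodes_E8 cartan_def edge_E_iff algebra_simps)

text \<open>The highest root of E7, the highest root of the D6 orthogonal to it, the highest root of
  D4 in the remaining D4 + A1, and the four simple roots that are then left.\<close>

definition cascade_E7 :: "int list list" where
  "cascade_E7 = [[2, 2, 3, 4, 3, 2, 1],
     [0, 1, 1, 2, 2, 2, 1],
     [0, 1, 1, 2, 1, 0, 0],
     [0, 0, 1, 0, 0, 0, 0],
     [0, 0, 0, 0, 0, 0, 1],
     [0, 0, 0, 0, 1, 0, 0],
     [0, 1, 0, 0, 0, 0, 0]]"

lemma orthogonal_frame_E7: "orthogonal_frame (diagram_E 7) (list_vec ` set cascade_E7)"
proof (rule orthogonal_frame_of_list[OF nodes_E])
  have "\<forall>xs\<in>set cascade_E7. \<forall>ys\<in>set cascade_E7.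
      form (diagram_E 7) (list_vec xs) (list_vec ys) = (if xs = ys then 2 else 0)"
    by (simp add: cascade_E7_def form_E7 list_vec_def)
  then show "form (diagram_E 7) (list_vec xs) (list_vec ys) = (if xs = ys then 2 else 0)"
    if "xs \<in> set cascade_E7" "ys \<in> set cascade_E7" for xs ys
    using that by blast
  have "\<forall>i\<in>nodes (diagram_E 7). \<forall>j\<in>nodes (diagram_E 7). 2 * simple_root i j =
      (\<Sum>xs\<leftarrow>cascade_E7. form (diagram_E 7) (simple_root i) (list_vec xs) * list_vec xs j)"
    by (simp add: nodes_E7 cascade_E7_def form_E7 list_vec_def simple_root_def)
  then show "2 * simple_root i j =
      (\<Sum>xs\<leftarrow>cascade_E7. form (diagram_E 7) (simple_root i) (list_vec xs) * list_vec xs j)"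
    if "i \<in> nodes (diagram_E 7)" "j \<in> nodes (diagram_E 7)" for i j
    using that by blast
qed (auto simp: cascade_E7_def)

text \<open>The highest root of E8 is orthogonal to the E7 on the nodes 1 to 7, whose cascade
  follows.\<close>

definition cascade_E8 :: "int list list" where
  "cascade_E8 = [[2, 3, 4, 6, 5, 4, 3, 2],
     [2, 2, 3, 4, 3, 2, 1, 0],
     [0, 1, 1, 2, 2, 2, 1, 0],
     [0, 1, 1, 2, 1, 0, 0, 0],
     [0, 0, 0, 0, 0, 0, 1, 0],
     [0, 1, 0, 0, 0, 0, 0, 0],
     [0, 0, 1, 0, 0, 0, 0, 0],
     [0, 0, 0, 0, 1, 0, 0, 0]]"

lemma orthogonal_frame_E8: "orthogonal_frame (diagram_E 8) (list_vec ` set cascade_E8)"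
proof (rule orthogonal_frame_of_list[OF nodes_E])
  have "\<forall>xs\<in>set cascade_E8. \<forall>ys\<in>set cascade_E8.
      form (diagram_E 8) (list_vec xs) (list_vec ys) = (if xs = ys then 2 else 0)"
    by (simp add: cascade_E8_def form_E8 list_vec_def)
  then show "form (diagram_E 8) (list_vec xs) (list_vec ys) = (if xs = ys then 2 else 0)"
    if "xs \<in> set cascade_E8" "ys \<in> set cascade_E8" for xs ys
    using that by blast
  have "\<forall>i\<in>nodes (diagram_E 8). \<forall>j\<in>nodes (diagram_E 8). 2 * simple_root i j =
      (\<Sum>xs\<leftarrow>cascade_E8. form (diagram_E 8) (simple_root i) (list_vec xs) * list_vec xs j)"
    by (simp add: nodes_E8 cascade_E8_def form_E8 list_vec_def simple_root_def)
  then show "2 * simple_root i j =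
      (\<Sum>xs\<leftarrow>cascade_E8. form (diagram_E 8) (simple_root i) (list_vec xs) * list_vec xs j)"
    if "i \<in> nodes (diagram_E 8)" "j \<in> nodes (diagram_E 8)" for i j
    using that by blast
qed (auto simp: cascade_E8_def)


section \<open>Type D\<close>

lemma nodes_D: "nodes (diagram_D n) = {1..n}"
  by (simp add: diagram_D_def)

lemma edge_D_iff: "{i, j} \<in> edges (diagram_D n) \<longleftrightarrow>
    1 \<le> i \<and> j = i + 1 \<and> j \<le> n - 1 \<or> 1 \<le> j \<and> i = j + 1 \<and> i \<le> n - 1 \<or>
    i = n - 2 \<and> j = n \<or> i = n \<and> j = n - 2"
  by (auto simp: diagram_D_def doubleton_eq_iff)

text \<open>Setting \<open>v 0 = 0\<close> gives node 1 a fictitious left neighbour, so it falls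
  under the generic case; \<open>n - 2\<close> is the branch node.\<close>

lemma form_simple_root_D:
  assumes n: "n \<ge> 4" and i: "i \<in> {1..n}" and v: "v 0 = 0"
  shows "form (diagram_D n) (simple_root i) v =
    (if i = n then 2 * v n - v (n - 2)
     else if i = n - 1 then 2 * v (n - 1) - v (n - 2)
     else if i = n - 2 then 2 * v (n - 2) - v (n - 3) - v (n - 1) - v n
     else 2 * v i - v (i - 1) - v (i + 1))"
proof -
  have e: "form (diagram_D n) (simple_root i) v = (\<Sum>j\<in>{1..n}. v j * cartan (diagram_D n) i j)"
    using form_simple_root_left[of "diagram_D n" i v] i by (simp add: nodes_D)
  have d: "(\<Sum>j\<in>{1..n}. if j = k then v k else 0) = v k" if "k \<le> n" for k
    using that v by (cases "k = 0") auto
  obtain m where m: "n = m + 4"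
    using n by (metis add.commute le_Suc_ex)
  note d' = d[OF order_refl] d[OF diff_le_self]
  consider "i = n" | "i = n - 1" | "i = n - 2" | "i < n - 2"
    using i by fastforce
  then show ?thesis
  proof cases
    case 1
    have "v j * cartan (diagram_D n) i j = 2 * (if j = n then v n else 0) - (if j = n - 2 then v (n - 2) else 0)"
      if "j \<in> {1..n}" for j
      using 1 that by (auto simp: m cartan_def edge_D_iff)
    then have "form (diagram_D n) (simple_root i) v = 2 * v n - v (n - 2)"
      unfolding e by (simp only: sum_subtractf d' cong: sum.cong flip: sum_distrib_left)
    then show ?thesis
      using 1 by simp
  next
    case 2
    have "v j * cartan (diagram_D n) i j = 2 * (if j = n - 1 then v (n - 1) else 0) - (if j = n - 2 then v (n - 2) else 0)"
      if "j \<in> {1..n}" for j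
      using 2 that by (auto simp: m cartan_def edge_D_iff)
    then have "form (diagram_D n) (simple_root i) v = 2 * v (n - 1) - v (n - 2)"
      unfolding e by (simp only: sum_subtractf d' cong: sum.cong flip: sum_distrib_left)
    then show ?thesis
      using 2 n by auto
  next
    case 3
    have "v j * cartan (diagram_D n) i j = 2 * (if j = n - 2 then v (n - 2) else 0)
        - (if j = n - 3 then v (n - 3) else 0) - (if j = n - 1 then v (n - 1) else 0) - (if j = n then v n else 0)"
      if "j \<in> {1..n}" for j
      using 3 that by (auto simp: m cartan_def edge_D_iff)
    then have "form (diagram_D n) (simple_root i) v = 2 * v (n - 2) - v (n - 3) - v (n - 1) - v n"
      unfolding e by (simp only: sum_subtractf d' cong: sum.cong flip: sum_distrib_left)
    then show ?thesis
      using 3 n by auto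
  next
    case 4
    then have i4: "i \<le> n" "i - 1 \<le> n" "i + 1 \<le> n"
      by linarith+
    have "v j * cartan (diagram_D n) i j = 2 * (if j = i then v i else 0)
        - (if j = i - 1 then v (i - 1) else 0) - (if j = i + 1 then v (i + 1) else 0)"
      if "j \<in> {1..n}" for j
      using 4 i that by (cases i) (auto simp: m cartan_def edge_D_iff)
    then have "form (diagram_D n) (simple_root i) v = 2 * v i - v (i - 1) - v (i + 1)"
      unfolding e by (simp only: sum_subtractf d' d[of i] d[of "i - 1"] d[of "i + 1"] i4 cong: sum.cong flip: sum_distrib_left)
    then show ?thesis
      using 4 n by auto
  qed
qed

text \<open>The root \<open>e\<^sub>j + e\<^sub>j\<^sub>+\<^sub>1\<close>, for \<open>j \<le> n - 3\<close>, in the standard coordinates of type D.\<close>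

definition sum_root_D :: "nat \<Rightarrow> nat \<Rightarrow> vec" where
  "sum_root_D n j = (\<lambda>m. of_bool (j \<le> m \<and> m \<le> n) + of_bool (j < m \<and> m \<le> n - 2))"

lemma form_simple_sum_root_D:
  assumes n: "n \<ge> 4" and i: "i \<in> {1..n}" and j: "1 \<le> j" "j \<le> n - 3"
  shows "form (diagram_D n) (simple_root i) (sum_root_D n j) = of_bool (i = j + 1) - of_bool (i + 1 = j)"
proof -
  have "sum_root_D n j 0 = 0"
    using j by (simp add: sum_root_D_def)
  note f = form_simple_root_D[where v = "sum_root_D n j", OF n i this]
  consider "i = n" | "i = n - 1" | "i = n - 2" | "i < n - 2"
    using i by fastforce
  then show ?thesis
    unfolding f by cases (use n i j in \<open>auto simp: sum_root_D_def\<close>)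
qed

text \<open>For k up to n - 2 the k-th standard coordinate of \<open>v\<close> is
  \<open>v k - v (k - 1)\<close>; adding the coordinates j and j + 1 telescopes.\<close>

lemma form_sum_root_D:
  assumes n: "n \<ge> 4" and v: "v 0 = 0" and j: "1 \<le> j" "j \<le> n - 3"
  shows "form (diagram_D n) v (sum_root_D n j) = v (j + 1) - v (j - 1)"
proof -
  have "form (diagram_D n) v (sum_root_D n j) =
      (\<Sum>i\<in>{1..n}. v i * form (diagram_D n) (simple_root i) (sum_root_D n j))"
    using form_expand_left[of "diagram_D n" v "sum_root_D n j"] by (simp only: nodes_D finite_atLeastAtMost)
  also have "\<dots> = (\<Sum>i\<in>{1..n}. (if i = j + 1 then v (j + 1) else 0) - (if i = j - 1 then v (j - 1) else 0))"
    using form_simple_sum_root_D[OF n _ j] j by (intro sum.cong) auto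
  also have "\<dots> = v (j + 1) - v (j - 1)"
    using n j v by (cases "j = 1") (auto simp: sum_subtractf)
  finally show ?thesis .
qed

text \<open>In standard coordinates these are the pairs \<open>e_j - e_(j+1)\<close> and
  \<open>e_j + e_(j+1)\<close> for odd j. The last root with a plus sign is the simple root
  \<open>n\<close>, to which the formula for \<open>sum_root_D\<close> does not extend.\<close>

definition cascade_D :: "nat \<Rightarrow> vec set" where
  "cascade_D n = simple_root ` {j. odd j \<and> j < n} \<union> {simple_root n} \<union>
     sum_root_D n ` {j. odd j \<and> j \<le> n - 3}"

lemma orthogonal_frame_D:
  assumes n: "n \<ge> 4" "even n"
  shows "orthogonal_frame (diagram_D n) (cascade_D n)"
proof
  let ?F = "form (diagram_D n)"
  define A where "A = insert n {j. odd j \<and> j < n}"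
  define G where "G = {j. odd j \<and> j \<le> n - 3}"
  have D: "cascade_D n = simple_root ` A \<union> sum_root_D n ` G"
    by (auto simp: cascade_D_def A_def G_def)
  have A: "1 \<le> i \<and> i \<le> n" if "i \<in> A" for i
    using that n by (auto simp: A_def intro: Suc_leI odd_pos)
  have G: "1 \<le> j \<and> j \<le> n - 3 \<and> odd j" if "j \<in> G" for j
    using that by (auto simp: G_def intro: Suc_leI odd_pos)
  have AA: "?F (simple_root i) (simple_root j) = (if i = j then 2 else 0)" if "i \<in> A" "j \<in> A" for i j
  proof -
    have "?F (simple_root i) (simple_root j) = (\<Sum>k\<in>{1..n}. simple_root j k * cartan (diagram_D n) i k)"
      using form_simple_root_left[of "diagram_D n" i "simple_root j"] A[OF that(1)] by (simp add: nodes_D)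
    also have "\<dots> = (\<Sum>k\<in>{1..n}. if k = j then cartan (diagram_D n) i j else 0)"
      by (intro sum.cong) (auto simp: simple_root_def)
    also have "\<dots> = cartan (diagram_D n) i j"
      using A[OF that(2)] by simp
    also have "\<dots> = (if i = j then 2 else 0)"
      using that n by (auto simp: cartan_def edge_D_iff A_def)
    finally show ?thesis .
  qed
  have AG: "?F (simple_root i) (sum_root_D n j) = 0" if "i \<in> A" "j \<in> G" for i j
    using form_simple_sum_root_D[of n i j] A[OF that(1)] G[OF that(2)] n that by (auto simp: A_def G_def)
  have GA: "?F (sum_root_D n j) (simple_root i) = 0" if "i \<in> A" "j \<in> G" for i j
    using AG[OF that] form_commute[of "diagram_D n" "simple_root i"] by simp
  have GG: "?F (sum_root_D n i) (sum_root_D n j) = (if i = j then 2 else 0)" if "i \<in> G" "j \<in> G" for i j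
  proof -
    have ij: "odd i" "odd j" "1 \<le> i" "1 \<le> j" "i \<le> n - 3" "j \<le> n - 3"
      using G that by auto
    have "?F (sum_root_D n i) (sum_root_D n j) = sum_root_D n i (j + 1) - sum_root_D n i (j - 1)"
      using form_sum_root_D[of n "sum_root_D n i" j] n ij by (simp add: sum_root_D_def)
    also consider "i = j" | "i + 2 \<le> j" | "j + 2 \<le> i"
      using ij(1,2) by (cases i j rule: linorder_cases) (auto elim!: oddE)
    then have "sum_root_D n i (j + 1) - sum_root_D n i (j - 1) = (if i = j then 2 else 0)"
      by cases (use n ij in \<open>auto simp: sum_root_D_def\<close>)
    finally show ?thesis .
  qed
  show "finite (nodes (diagram_D n))"
    by (simp add: nodes_D)
  have "finite A" "finite G"
    by (simp_all add: A_def G_def)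
  then show fin: "finite (cascade_D n)"
    by (simp add: D)
  show "cascade_D n \<noteq> {}"
    by (simp add: cascade_D_def)
  show "supported (diagram_D n) \<beta>" if "\<beta> \<in> cascade_D n" for \<beta>
    using that A G by (fastforce simp: D supported_def nodes_D simple_root_def sum_root_D_def)
  show "0 \<le> \<beta> i" if "\<beta> \<in> cascade_D n" for \<beta> i
    using that by (auto simp: D simple_root_def sum_root_D_def)
  show "?F \<beta> \<beta> = 2" if "\<beta> \<in> cascade_D n" for \<beta>
    using that AA GG by (auto simp: D)
  show "orthogonal_set (diagram_D n) (cascade_D n)"
    using AA AG GG GA
    by (auto simp: D orthogonal_set_def pairwise_def)
  fix i
  assume "i \<in> nodes (diagram_D n)"
  then have i: "1 \<le> i" "i \<le> n"
    by (auto simp: nodes_D)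
  show "\<exists>f. \<forall>j. 2 * simple_root i j = (\<Sum>\<beta>\<in>cascade_D n. f \<beta> * \<beta> j)"
  proof (cases "i \<in> A")
    case True
    then have m: "simple_root i \<in> cascade_D n"
      by (simp add: D)
    show ?thesis
      by (rule span4[OF fin m m m m, of _ 2 0 0 0]) simp
  next
    case False
    then have e: "even i" "i < n"
      using i by (auto simp: A_def)
    then have i2: "2 \<le> i" "i \<le> n - 2"
      using i n by presburger+
    have i3: "i + 1 \<le> n - 3" if "i \<noteq> n - 2"
      using that e i2 n by presburger
    \<comment> \<open>For even i, twice \<open>e_i - e_(i+1)\<close> is \<open>e_(i-1) + e_i\<close>
      minus the three roots \<open>e_(i-1) - e_i\<close>, \<open>e_(i+1) - e_(i+2)\<close> and
      \<open>e_(i+1) + e_(i+2)\<close>. The last of these is \<open>t\<close>.\<close>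
    define t where "t = (if i = n - 2 then simple_root n else sum_root_D n (i + 1))"
    have m: "sum_root_D n (i - 1) \<in> cascade_D n" "simple_root (i - 1) \<in> cascade_D n"
      "simple_root (i + 1) \<in> cascade_D n" "t \<in> cascade_D n"
      using e i2 i3 n by (auto simp: cascade_D_def t_def)
    obtain q where q: "i = q + 2"
      using i2(1) by (metis add.commute le_Suc_ex)
    have "2 * simple_root i j = 1 * sum_root_D n (i - 1) j + (-1) * simple_root (i - 1) j
        + (-1) * simple_root (i + 1) j + (-1) * t j" for j
    proof (cases "i = n - 2")
      case True
      then have "n = q + 4"
        using q n by linarith
      then show ?thesis
        by (auto simp: q sum_root_D_def simple_root_def t_def)
    next
      case ne: False
      then have "q + 6 \<le> n"
        using i3 q n(1) by linarith
      then obtain r where "n = q + 6 + r"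
        by (rule less_eqE)
      then show ?thesis
        using ne by (auto simp: q sum_root_D_def simple_root_def t_def)
    qed
    then show ?thesis
      by (rule span4[OF fin m])
  qed
qed

theorem theorem4p3:
  fixes \<Gamma> :: diagram
  assumes "\<Gamma> = diagram_E 7 \<or> \<Gamma> = diagram_E 8 \<or>
    (\<exists>n k. n = 2 * k \<and> n \<ge> 4 \<and> \<Gamma> = diagram_D n)"
  shows "transitive_QP_triple \<Gamma> (simple_reflections \<Gamma>) (positive_roots \<Gamma>)"
  using assms orthogonal_frame_E7 orthogonal_frame_E8 orthogonal_frame_D
    orthogonal_frame.transitive_QP by fastforce

end
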